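(* For any $q\ge1$, any integers $n,p\ge1$ and any $\sigma,B\ge0$, \[ \frac14\Big[\mathcal{E}^*_{q,\infty}\big(\sigma,B,\tau_q(\sigma,B)\big)+\frac1n\mathcal{M}_q(\sigma,B)\Big]\;\le\;\mathcal{E}_q(\sigma,B)\;\le\;128\Big[\mathcal{E}^*_{q,\infty}\big(\sigma,B,\tau_q(\sigma,B)\big)+\frac1n\mathcal{M}_q(\sigma,B)\Big]. \] Moreover, both inequalities continue to hold when $\mathcal{M}_q(\sigma,B)$ is replaced by $\mathcal{M}_q'(\sigma,B)$.
   Context: For independent random vectors $\boldsymbol{X}_1,\dots,\boldsymbol{X}_n$ in $\mathbb{R}^p$ with joint law $P^n$ and $\mathbb{E}[\boldsymbol{X}_i]=0$, set $\mathcal{V}(P^n)=\max_{j}\frac1n\sum_i\mathbb{E}[X_i(j)^2]$ and $\mathcal{D}_q(P^n)=(\frac1n\sum_i\mathbb{E}[\max_j|X_i(j)|^q])^{1/q}$, and let $\mathcal{E}_q(\sigma,B)$ be the supremum of $\mathbb{E}[\max_{1\le j\le p}|\frac1n\sum_{i=1}^nX_i(j)|]$ over all such laws with $\mathcal{V}(P^n)\le\sigma^2$, $\mathcal{D}_q(P^n)\le B$. Let $\mathcal{P}_q(\sigma,B)$ be the set of distributions $P$ on $\mathbb{R}^p$ with $\mathbb{E}_P[\boldsymbol{X}]=0$, $\max_j\mathbb{E}_P[X(j)^2]\le\sigma^2$, $(\mathbb{E}_P\|\boldsymbol{X}\|_\infty^q)^{1/q}\le B$. Let $\mathcal{P}_{q,\infty}(\sigma,B_q,B_\infty)=\{P\in\mathcal{P}_q(\sigma,B_q):\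 \mathbb{P}_P(\|\boldsymbol{X}\|_\infty>B_\infty)=0\}$ and $\mathcal{E}^*_{q,\infty}(\sigma,B_q,B_\infty)=\sup\{\mathbb{E}_P\|\frac1n\sum_{i=1}^n\boldsymbol{X}_i\|_\infty:\ \boldsymbol{X}_1,\dots,\boldsymbol{X}_n\overset{iid}{\sim}P,\ P\in\mathcal{P}_{q,\infty}(\sigma,B_q,B_\infty)\}$. For a distribution $P$ on $\mathbb{R}^p$ let $T(P;n)=\inf\{t\ge0:\ \mathbb{P}_P(\|\boldsymbol{X}\|_\infty>t)\le 1/(8n)\}$, and define $\tau_q(\sigma,B)=\sup\{T(P;n):P\in\mathcal{P}_q(\sigma,B)\}$, $\mathcal{M}_q(\sigma,B)=\sup\{\mathbb{E}_P[\max_{1\le i\le n}\|\boldsymbol{X}_i\|_\infty]:\ \boldsymbol{X}_i\overset{iid}{\sim}P,\ P\in\mathcal{P}_q(\sigma,B)\}$, and $\mathcal{M}'_q(\sigma,B)=\sup\{\mathbb{E}_P[\max_{1\le i\le n}\|\boldsymbol{X}_i\|_\infty\mathbf{1}\{\|\boldsymbol{X}_i\|_\infty>\tau_q(\sigma,B)\}]:\ \boldsymbol{X}_i\overset{iid}{\sim}P,\ P\in\mathcal{P}_q(\sigma,B)\}$. *)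

theory Defs
  imports "HOL-Probability.Probability"
begin

text \<open>Vectors in R^p are modelled as real^'p for a finite index type 'p (p = CARD('p) >= 1).\<close>

definition linf :: "real^'p::finite \<Rightarrow> real" where
  "linf x = Max (range (\<lambda>j. \<bar>x $ j\<bar>))"

definition law_mean0 :: "(real^'p::finite) measure \<Rightarrow> bool" where
  "law_mean0 P \<longleftrightarrow> prob_space P \<and> sets P = sets borel \<and>
     (\<forall>j. integrable P (\<lambda>x. x $ j) \<and> (\<integral>x. x $ j \<partial>P) = 0)"

definition Pq :: "'p::finite itself \<Rightarrow> real \<Rightarrow> real \<Rightarrow> real \<Rightarrow> (real^'p) measure set" where
  "Pq _ q \<sigma> B = {P. law_mean0 P \<and>
      (\<forall>j. (\<integral>\<^sup>+x. ennreal ((x $ j)^2) \<partial>P) \<le> ennreal (\<sigma>^2)) \<and>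
      (\<integral>\<^sup>+x. ennreal (linf x powr q) \<partial>P) \<le> ennreal (B powr q)}"

text \<open>E_q(sigma,B): independent, not necessarily identically distributed X_1..X_n
  (indices 0..n-1), joint law the product of the marginals P_i.\<close>
definition Eq :: "'p::finite itself \<Rightarrow> nat \<Rightarrow> real \<Rightarrow> real \<Rightarrow> real \<Rightarrow> ennreal" where
  "Eq _ n q \<sigma> B = (SUP Ps \<in> {Ps :: nat \<Rightarrow> (real^'p) measure.
        (\<forall>i<n. law_mean0 (Ps i)) \<and>
        (\<forall>j. ennreal (1 / real n) * (\<Sum>i<n. \<integral>\<^sup>+x. ennreal ((x $ j)^2) \<partial>Ps i) \<le> ennreal (\<sigma>^2)) \<and>
        ennreal (1 / real n) * (\<Sum>i<n. \<integral>\<^sup>+x. ennreal (linf x powr q) \<partial>Ps i) \<le> ennreal (B powr q)}.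
      \<integral>\<^sup>+\<omega>. ennreal (linf ((1 / real n) *\<^sub>R (\<Sum>i<n. \<omega> i))) \<partial>(PiM {..<n} Ps))"

definition Pqinf :: "'p::finite itself \<Rightarrow> real \<Rightarrow> real \<Rightarrow> real \<Rightarrow> real \<Rightarrow> (real^'p) measure set" where
  "Pqinf t q \<sigma> Bq Binf = {P \<in> Pq t q \<sigma> Bq. emeasure P {x. linf x > Binf} = 0}"

definition Estar :: "'p::finite itself \<Rightarrow> nat \<Rightarrow> real \<Rightarrow> real \<Rightarrow> real \<Rightarrow> real \<Rightarrow> ennreal" where
  "Estar t n q \<sigma> Bq Binf = (SUP P \<in> Pqinf t q \<sigma> Bq Binf.
      \<integral>\<^sup>+\<omega>. ennreal (linf ((1 / real n) *\<^sub>R (\<Sum>i<n. \<omega> i))) \<partial>(PiM {..<n} (\<lambda>_. P)))"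

definition Tthr :: "(real^'p::finite) measure \<Rightarrow> nat \<Rightarrow> real" where
  "Tthr P n = Inf {t. t \<ge> 0 \<and> measure P {x. linf x > t} \<le> 1 / (8 * real n)}"

definition tau :: "'p::finite itself \<Rightarrow> nat \<Rightarrow> real \<Rightarrow> real \<Rightarrow> real \<Rightarrow> real" where
  "tau t n q \<sigma> B = Sup ((\<lambda>P. Tthr P n) ` Pq t q \<sigma> B)"

definition Mq :: "'p::finite itself \<Rightarrow> nat \<Rightarrow> real \<Rightarrow> real \<Rightarrow> real \<Rightarrow> ennreal" where
  "Mq t n q \<sigma> B = (SUP P \<in> Pq t q \<sigma> B.
      \<integral>\<^sup>+\<omega>. ennreal (Max ((\<lambda>i. linf (\<omega> i)) ` {..<n})) \<partial>(PiM {..<n} (\<lambda>_. P)))"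

definition Mq' :: "'p::finite itself \<Rightarrow> nat \<Rightarrow> real \<Rightarrow> real \<Rightarrow> real \<Rightarrow> ennreal" where
  "Mq' t n q \<sigma> B = (SUP P \<in> Pq t q \<sigma> B.
      \<integral>\<^sup>+\<omega>. ennreal (Max ((\<lambda>i. linf (\<omega> i) *
            (if linf (\<omega> i) > tau t n q \<sigma> B then 1 else 0)) ` {..<n})) \<partial>(PiM {..<n} (\<lambda>_. P)))"

end

theory Submission
  imports Defs
begin

text \<open>
  Lower bound: \<open>Eq\<close> allows non-identical laws, so \<open>X\<^sub>i\<close> may be replaced by \<open>s\<^sub>i X\<^sub>i\<close> for any fixed signs; the
  average of \<open>linf (\<Sum>i. s\<^sub>i x\<^sub>i)\<close> over all signs dominates each \<open>linf x\<^sub>k\<close> (flip every sign except the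
  k-th), hence \<open>Mq \<le> n Eq\<close>.

  Upper bound: let \<open>Q\<close> be the uniform mixture of the \<open>P\<^sub>i\<close> and their reflections. An i.i.d. sample
  from \<open>Q\<close> draws \<open>P\<^sub>i\<close> itself with probability at least 1/3; conditioning on the drawn indices, discarding
  centered independent summands by Jensen's inequality and averaging gives
  \<open>E linf (\<Sum>i. X\<^sub>i) \<le> 3 E linf (\<Sum>i. Y\<^sub>i)\<close>. Since \<open>Q\<close> is symmetric, truncating \<open>Y\<close> at \<open>tau\<close> preserves the
  mean and the moment bounds, so the truncated part is controlled by \<open>Estar\<close>. Exceedances have
  probability at most \<open>1 / (8 n)\<close>, hence rarely occur twice, and their sum is comparable in
  expectation to their maximum.
\<close>

section \<open>The maximum norm and finite product measures\<close>

text \<open>Identification with the library's \<open>infnorm\<close>, from which the norm axioms and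
  continuity, hence Borel measurability, are inherited.\<close>

lemma linf_eq_infnorm: "linf x = infnorm x"
proof -
  have "{\<bar>x $ i\<bar> |i. i \<in> UNIV} = range (\<lambda>j. \<bar>x $ j\<bar>)" by auto
  then show ?thesis
    unfolding linf_def infnorm_cart by (simp add: cSup_eq_Max)
qed

lemma linf_nonneg [simp]: "0 \<le> linf x"
  by (simp add: linf_eq_infnorm infnorm_pos_le)

lemma linf_zero [simp]: "linf 0 = 0"
  by (simp add: linf_eq_infnorm infnorm_0)

lemma linf_minus [simp]: "linf (- x) = linf x"
  by (simp add: linf_eq_infnorm infnorm_neg)

lemma linf_scaleR: "linf (a *\<^sub>R x) = \<bar>a\<bar> * linf x"
  by (simp add: linf_eq_infnorm infnorm_mul)

lemma linf_triangle: "linf (x + y) \<le> linf x + linf y"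
  by (simp add: linf_eq_infnorm infnorm_triangle)

lemma linf_sum: "linf (\<Sum>i\<in>A. f i) \<le> (\<Sum>i\<in>A. linf (f i))"
proof (induction A rule: infinite_finite_induct)
  case (insert a A)
  then show ?case using linf_triangle[of "f a" "sum f A"] by simp
qed auto

lemma component_le_linf: "\<bar>x $ j\<bar> \<le> linf x"
  by (simp add: linf_eq_infnorm component_le_infnorm_cart)

lemma linf_attained: "\<exists>j. linf x = \<bar>x $ j\<bar>"
proof -
  have "linf x \<in> range (\<lambda>j. \<bar>x $ j\<bar>)" unfolding linf_def by (rule Max_in) auto
  then show ?thesis by auto
qed

lemma borel_measurable_linf [measurable]: "linf \<in> borel_measurable borel"
  unfolding linf_eq_infnorm[abs_def]
  by (intro borel_measurable_continuous_onI continuous_intros)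

lemma borel_measurable_vec_nth_cart [measurable]:
  "(\<lambda>x::real^'p::finite. x $ j) \<in> borel_measurable borel"
  by (intro borel_measurable_continuous_onI continuous_intros)

section \<open>Finite product measures: reindexing, marginals and coordinatewise images\<close>

lemma nn_integral_PiM_reindex:
  assumes "\<And>i. i \<in> K \<Longrightarrow> prob_space (M i)" "inj_on f I" "f \<in> I \<rightarrow> K"
    and g: "g \<in> borel_measurable (\<Pi>\<^sub>M i\<in>I. M (f i))"
  shows "(\<integral>\<^sup>+x. g x \<partial>(\<Pi>\<^sub>M i\<in>I. M (f i))) = (\<integral>\<^sup>+x. g (\<lambda>i\<in>I. x (f i)) \<partial>PiM K M)"
proof -
  have "(\<lambda>\<omega>. \<lambda>n\<in>I. \<omega> (f n)) \<in> PiM K M \<rightarrow>\<^sub>M (\<Pi>\<^sub>M i\<in>I. M (f i))"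
    using assms(3) by (intro measurable_restrict measurable_component_singleton) auto
  then show ?thesis
    by (subst distr_PiM_reindex[OF assms(1-3), symmetric]) (simp_all add: nn_integral_distr g)
qed

lemma nn_integral_PiM_component:
  assumes "\<And>i. i \<in> I \<Longrightarrow> prob_space (M i)" "i \<in> I" "g \<in> borel_measurable (M i)"
  shows "(\<integral>\<^sup>+x. g (x i) \<partial>PiM I M) = (\<integral>\<^sup>+x. g x \<partial>M i)"
  using nn_integral_distr[of "\<lambda>x. x i" "PiM I M" "M i" g] assms
  by (simp add: distr_PiM_component)

text \<open>The preimage of a rectangle under a coordinatewise map is again a rectangle, and a
  finite product measure is determined by its values on rectangles. This is how sign changes and
  truncation are moved between the integrand and the marginals.\<close>

lemma PiM_distr_eq:
  assumes I: "finite I" and M: "\<And>i. i \<in> I \<Longrightarrow> prob_space (M i)"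
    and f: "\<And>i. i \<in> I \<Longrightarrow> f i \<in> M i \<rightarrow>\<^sub>M N i"
  shows "(\<Pi>\<^sub>M i\<in>I. distr (M i) (N i) (f i)) = distr (PiM I M) (PiM I N) (\<lambda>x. \<lambda>i\<in>I. f i (x i))"
proof -
  \<comment> \<open>The locale for product measures asks for a sigma-finite measure at every index,
    so both families are filled with a point mass outside \<open>I\<close>; the products over
    \<open>I\<close> stay the same.\<close>
  define M' where "M' i = (if i \<in> I then M i else return (count_space UNIV) undefined)" for i
  define N' where "N' i = (if i \<in> I then distr (M i) (N i) (f i) else return (count_space UNIV) undefined)" for i
  have M': "prob_space (M' i)" for i
    by (auto simp: M'_def M intro!: prob_space_return)
  have N': "prob_space (N' i)" for i
    by (auto simp: N'_def M f intro!: prob_space_return prob_space.prob_space_distr)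
  interpret M: product_sigma_finite M'
    by (rule product_sigma_finite.intro) (rule prob_space_imp_sigma_finite[OF M'])
  interpret N: product_sigma_finite N'
    by (rule product_sigma_finite.intro) (rule prob_space_imp_sigma_finite[OF N'])
  have eqM: "PiM I M = PiM I M'" and eqN: "(\<Pi>\<^sub>M i\<in>I. distr (M i) (N i) (f i)) = PiM I N'"
    by (auto intro!: PiM_cong simp: M'_def N'_def)
  have m[measurable]: "(\<lambda>x. \<lambda>i\<in>I. f i (x i)) \<in> PiM I M \<rightarrow>\<^sub>M PiM I N"
  proof (rule measurable_restrict)
    fix i assume i: "i \<in> I"
    show "(\<lambda>x. f i (x i)) \<in> PiM I M \<rightarrow>\<^sub>M N i"
      by (rule measurable_compose[OF _ f[OF i]]) (rule measurable_component_singleton[OF i])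
  qed
  have "distr (PiM I M) (PiM I N) (\<lambda>x. \<lambda>i\<in>I. f i (x i)) = PiM I N'"
  proof (rule N.PiM_eqI[OF I])
    show "sets (distr (PiM I M) (PiM I N) (\<lambda>x. \<lambda>i\<in>I. f i (x i))) = sets (PiM I N')"
      by (auto simp: N'_def intro!: sets_PiM_cong)
    fix A assume A: "\<And>i. i \<in> I \<Longrightarrow> A i \<in> sets (N' i)"
    then have A': "A i \<in> sets (N i)" if "i \<in> I" for i using that by (force simp: N'_def)
    have "emeasure (distr (PiM I M) (PiM I N) (\<lambda>x. \<lambda>i\<in>I. f i (x i))) (Pi\<^sub>E I A) =
        emeasure (PiM I M) ((\<lambda>x. \<lambda>i\<in>I. f i (x i)) -` (Pi\<^sub>E I A) \<inter> space (PiM I M))"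
      using A' by (intro emeasure_distr m sets_PiM_I_finite I) auto
    also have "(\<lambda>x. \<lambda>i\<in>I. f i (x i)) -` (Pi\<^sub>E I A) \<inter> space (PiM I M)
        = (\<Pi>\<^sub>E i\<in>I. f i -` A i \<inter> space (M i))"
      by (auto simp: space_PiM PiE_iff)
    also have "emeasure (PiM I M) \<dots> = (\<Prod>i\<in>I. emeasure (M i) (f i -` A i \<inter> space (M i)))"
      unfolding eqM using A' f
      by (subst M.emeasure_PiM[OF I]) (auto simp: M'_def intro!: prod.cong measurable_sets)
    also have "\<dots> = (\<Prod>i\<in>I. emeasure (N' i) (A i))"
      using A' f by (intro prod.cong) (auto simp: N'_def emeasure_distr)
    finally show "emeasure (distr (PiM I M) (PiM I N) (\<lambda>x. \<lambda>i\<in>I. f i (x i))) (Pi\<^sub>E I A) = (\<Prod>i\<in>I. emeasure (N' i) (A i))" .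
  qed
  then show ?thesis by (simp add: eqN)
qed

section \<open>Centered laws and the effect of adding independent summands\<close>

lemma prob_space_law_mean0: "law_mean0 P \<Longrightarrow> prob_space P"
  and sets_law_mean0: "law_mean0 P \<Longrightarrow> sets P = sets borel"
  by (auto simp: law_mean0_def)

lemma borel_measurable_sum_PiM:
  assumes "\<And>i. i \<in> I \<Longrightarrow> sets (M i) = sets (borel :: (real^'p::finite) measure)" "A \<subseteq> I"
  shows "(\<lambda>\<omega>. \<Sum>i\<in>A. \<omega> i) \<in> borel_measurable (PiM I M)"
proof (rule borel_measurable_sum)
  fix i assume "i \<in> A"
  with assms have i: "i \<in> I" "sets (M i) = sets borel" by auto
  then have "(\<lambda>x. x i) \<in> PiM I M \<rightarrow>\<^sub>M M i" by simp
  then show "(\<lambda>x. x i) \<in> borel_measurable (PiM I M)"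
    using measurable_cong_sets[OF refl i(2)] by blast
qed

text \<open>Jensen's inequality for adding a centered independent summand, coordinatewise.\<close>
lemma linf_le_nn_integral_add:
  assumes P: "law_mean0 (P :: (real^'p::finite) measure)"
  shows "ennreal (linf a) \<le> (\<integral>\<^sup>+y. ennreal (linf (y + a)) \<partial>P)"
proof -
  interpret prob_space P using P by (rule prob_space_law_mean0)
  obtain j where j: "linf a = \<bar>a $ j\<bar>" using linf_attained by blast
  have int: "integrable P (\<lambda>y. y $ j)" and zero: "(\<integral>y. y $ j \<partial>P) = 0"
    using P by (auto simp: law_mean0_def)
  have "a $ j = (\<integral>y. (y + a) $ j \<partial>P)"
    using int zero by (simp add: prob_space)
  then have "ennreal (linf a) = ennreal \<bar>\<integral>y. (y + a) $ j \<partial>P\<bar>" using j by simp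
  also have "\<dots> \<le> ennreal (\<integral>y. \<bar>(y + a) $ j\<bar> \<partial>P)"
    by (intro ennreal_leI integral_abs_bound)
  also have "\<dots> = (\<integral>\<^sup>+y. ennreal \<bar>(y + a) $ j\<bar> \<partial>P)"
    using int by (intro nn_integral_eq_integral[symmetric]) auto
  also have "\<dots> \<le> (\<integral>\<^sup>+y. ennreal (linf (y + a)) \<partial>P)"
    by (intro nn_integral_mono ennreal_leI component_le_linf)
  finally show ?thesis .
qed

text \<open>The indices of \<open>B - A\<close> are added one at a time. Fubini isolates the new
  coordinate, and Jensen's inequality applies to it with the sum of the others held fixed.\<close>

lemma nn_integral_linf_sum_mono:
  fixes L :: "'i \<Rightarrow> (real^'p::finite) measure"
  assumes L: "\<And>i. law_mean0 (L i)" and AB: "finite B" "A \<subseteq> B"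
  shows "(\<integral>\<^sup>+\<omega>. ennreal (linf (\<Sum>i\<in>A. \<omega> i)) \<partial>PiM A L) \<le> (\<integral>\<^sup>+\<omega>. ennreal (linf (\<Sum>i\<in>B. \<omega> i)) \<partial>PiM B L)"
proof -
  interpret product_sigma_finite L
    by (rule product_sigma_finite.intro) (rule prob_space_imp_sigma_finite[OF prob_space_law_mean0[OF L]])
  note [measurable_cong] = sets_law_mean0[OF L]
  have meas: "(\<lambda>\<omega>. ennreal (linf (\<Sum>i\<in>C. \<omega> i))) \<in> borel_measurable (PiM C L)" for C :: "'i set"
    using borel_measurable_sum_PiM[of C L C] sets_law_mean0[OF L] by measurable
  have step: "(\<integral>\<^sup>+\<omega>. ennreal (linf (\<Sum>i\<in>A. \<omega> i)) \<partial>PiM A L)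
     \<le> (\<integral>\<^sup>+\<omega>. ennreal (linf (\<Sum>i\<in>A \<union> C. \<omega> i)) \<partial>PiM (A \<union> C) L)"
    if "finite C" "C \<inter> A = {}" for C
    using that
  proof (induction C)
    case (insert c C)
    let ?D = "A \<union> C"
    have D: "finite ?D" "c \<notin> ?D" using insert AB finite_subset by auto
    have "(\<integral>\<^sup>+\<omega>. ennreal (linf (\<Sum>i\<in>?D. \<omega> i)) \<partial>PiM ?D L)
        \<le> (\<integral>\<^sup>+\<omega>. (\<integral>\<^sup>+y. ennreal (linf (y + (\<Sum>i\<in>?D. \<omega> i))) \<partial>L c) \<partial>PiM ?D L)"
      by (intro nn_integral_mono linf_le_nn_integral_add L)
    also have "\<dots> = (\<integral>\<^sup>+x. (\<integral>\<^sup>+y. ennreal (linf (\<Sum>i\<in>insert c ?D. (x(c := y)) i)) \<partial>L c) \<partial>PiM ?D L)"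
    proof -
      have "(\<Sum>i\<in>insert c ?D. (x(c := y)) i) = y + (\<Sum>i\<in>?D. x i)" for x :: "'i \<Rightarrow> real^'p" and y :: "real^'p"
      proof -
        have "(\<Sum>i\<in>?D. (x(c := y)) i) = (\<Sum>i\<in>?D. x i)"
          using D by (intro sum.cong) auto
        then show ?thesis using D by (subst sum.insert) auto
      qed
      then show ?thesis by simp
    qed
    also have "\<dots> = (\<integral>\<^sup>+\<omega>. ennreal (linf (\<Sum>i\<in>insert c ?D. \<omega> i)) \<partial>PiM (insert c ?D) L)"
      by (rule product_nn_integral_insert[symmetric, OF D meas])
    finally show ?case using insert by (auto intro: order_trans)
  qed simp
  show ?thesis using step[of "B - A"] AB by (auto simp: Un_absorb1)
qed

section \<open>Sampling with replacement from a mixture\<close>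

text \<open>Multilinearity of the product measure: expanding a product of averages gives one term
  per index map \<open>I\<close>. The induction splits off one coordinate and expands both factors.
  The weights \<open>1 / m\<close> are multiplied out, so no division in \<open>ennreal\<close>
  occurs.\<close>

lemma nn_integral_PiM_mixture:
  fixes L :: "'k \<Rightarrow> 'a measure" and f :: "('i \<Rightarrow> 'a) \<Rightarrow> ennreal"
  assumes L: "\<And>k. prob_space (L k)" "\<And>k. sets (L k) = sets M"
    and Q: "prob_space Q" "sets Q = sets M"
    and mix: "\<And>f. f \<in> borel_measurable M \<Longrightarrow>
        of_nat m * (\<integral>\<^sup>+x. f x \<partial>Q) = (\<Sum>k\<in>K. \<integral>\<^sup>+x. f x \<partial>L k)"
    and A: "finite A" and f: "f \<in> borel_measurable (PiM A (\<lambda>_. M))"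
  shows "of_nat m ^ card A * (\<integral>\<^sup>+\<omega>. f \<omega> \<partial>PiM A (\<lambda>_. Q)) =
    (\<Sum>I\<in>A \<rightarrow>\<^sub>E K. \<integral>\<^sup>+\<omega>. f \<omega> \<partial>(\<Pi>\<^sub>M i\<in>A. L (I i)))"
  using A f
proof (induction A arbitrary: f)
  case empty
  then show ?case by (simp add: PiM_empty nn_integral_count_space_finite)
next
  case (insert a A)
  interpret PQ: product_sigma_finite "\<lambda>_::'i. Q"
    by (rule product_sigma_finite.intro) (rule prob_space_imp_sigma_finite[OF Q(1)])
  have PL: "product_sigma_finite (\<lambda>i::'i. L (I i))" for I
    by (rule product_sigma_finite.intro) (rule prob_space_imp_sigma_finite[OF L(1)])
  have sL: "sets (\<Pi>\<^sub>M i\<in>B. L (I i)) = sets (PiM B (\<lambda>_. M))"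
    and sQ: "sets (PiM B (\<lambda>_. Q)) = sets (PiM B (\<lambda>_. M))" for B :: "'i set" and I
    by (auto intro!: sets_PiM_cong simp: L Q)
  have [measurable]: "(\<lambda>(y, x). f (x(a := y))) \<in> borel_measurable (M \<Otimes>\<^sub>M PiM A (\<lambda>_. M))"
    using insert.prems by measurable
  have slice: "(\<lambda>x. f (x(a := y))) \<in> borel_measurable (PiM A (\<lambda>_. M))" if "y \<in> space M" for y
    using that by measurable
  have inner [measurable]: "(\<lambda>y. \<integral>\<^sup>+x. f (x(a := y)) \<partial>N) \<in> borel_measurable M"
    if "sigma_finite_measure N" "sets N = sets (PiM A (\<lambda>_. M))" for N
  proof -
    note [measurable_cong] = that(2)
    show ?thesis by (rule sigma_finite_measure.borel_measurable_nn_integral[OF that(1)]) measurable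
  qed
  have sfL: "sigma_finite_measure (\<Pi>\<^sub>M i\<in>A. L (I i))" for I
    by (intro prob_space_imp_sigma_finite prob_space_PiM L)
  have sfQ: "sigma_finite_measure (PiM A (\<lambda>_. Q))"
    by (intro prob_space_imp_sigma_finite prob_space_PiM Q)
  have mQ: "g \<in> borel_measurable Q \<longleftrightarrow> g \<in> borel_measurable M"
    and mL: "g \<in> borel_measurable (L k) \<longleftrightarrow> g \<in> borel_measurable M" for g :: "'a \<Rightarrow> ennreal" and k
    by (simp_all only: measurable_cong_sets[OF Q(2) refl] measurable_cong_sets[OF L(2) refl])
  have fQ: "f \<in> borel_measurable (PiM (insert a A) (\<lambda>_. Q))"
    using insert.prems by (simp only: measurable_cong_sets[OF sQ refl])
  have fL: "f \<in> borel_measurable (\<Pi>\<^sub>M i\<in>insert a A. L (I i))" for I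
    using insert.prems by (simp only: measurable_cong_sets[OF sL refl])
  have "(\<integral>\<^sup>+\<omega>. f \<omega> \<partial>PiM (insert a A) (\<lambda>_. Q)) = (\<integral>\<^sup>+y. (\<integral>\<^sup>+x. f (x(a := y)) \<partial>PiM A (\<lambda>_. Q)) \<partial>Q)"
    by (intro PQ.product_nn_integral_insert_rev insert.hyps fQ)
  then have "of_nat m ^ card (insert a A) * (\<integral>\<^sup>+\<omega>. f \<omega> \<partial>PiM (insert a A) (\<lambda>_. Q)) =
      of_nat m * (of_nat m ^ card A * (\<integral>\<^sup>+y. (\<integral>\<^sup>+x. f (x(a := y)) \<partial>PiM A (\<lambda>_. Q)) \<partial>Q))"
    using insert.hyps by (simp add: mult.assoc)
  also have "of_nat m ^ card A * (\<integral>\<^sup>+y. (\<integral>\<^sup>+x. f (x(a := y)) \<partial>PiM A (\<lambda>_. Q)) \<partial>Q) =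
      (\<integral>\<^sup>+y. of_nat m ^ card A * (\<integral>\<^sup>+x. f (x(a := y)) \<partial>PiM A (\<lambda>_. Q)) \<partial>Q)"
    by (rule nn_integral_cmult[symmetric]) (simp add: mQ inner sfQ sQ)
  also have "\<dots> = (\<integral>\<^sup>+y. (\<Sum>I\<in>A \<rightarrow>\<^sub>E K. \<integral>\<^sup>+x. f (x(a := y)) \<partial>(\<Pi>\<^sub>M i\<in>A. L (I i))) \<partial>Q)"
    by (intro nn_integral_cong insert.IH slice) (simp add: sets_eq_imp_space_eq[OF Q(2)])
  \<comment> \<open>The mixture identity for the new coordinate \<open>a\<close>, applied to the
    expansion already obtained for the coordinates in \<open>A\<close>.\<close>
  also have "of_nat m * \<dots> = (\<Sum>k\<in>K. \<integral>\<^sup>+y. (\<Sum>I\<in>A \<rightarrow>\<^sub>E K. \<integral>\<^sup>+x. f (x(a := y)) \<partial>(\<Pi>\<^sub>M i\<in>A. L (I i))) \<partial>L k)"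
    by (intro mix borel_measurable_sum inner sfL sL)
  also have "\<dots> = (\<Sum>k\<in>K. \<Sum>I\<in>A \<rightarrow>\<^sub>E K. \<integral>\<^sup>+y. \<integral>\<^sup>+x. f (x(a := y)) \<partial>(\<Pi>\<^sub>M i\<in>A. L (I i)) \<partial>L k)"
    by (intro sum.cong refl nn_integral_sum) (simp add: mL inner sfL sL)
  also have "\<dots> = (\<Sum>k\<in>K. \<Sum>I\<in>A \<rightarrow>\<^sub>E K. \<integral>\<^sup>+\<omega>. f \<omega> \<partial>(\<Pi>\<^sub>M i\<in>insert a A. L ((I(a := k)) i)))"
  proof (intro sum.cong refl)
    fix k I
    interpret PI: product_sigma_finite "\<lambda>i. L ((I(a := k)) i)" by (rule PL)
    have "(\<Pi>\<^sub>M i\<in>A. L ((I(a := k)) i)) = (\<Pi>\<^sub>M i\<in>A. L (I i))"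
      using insert.hyps by (intro PiM_cong) auto
    then show "(\<integral>\<^sup>+y. \<integral>\<^sup>+x. f (x(a := y)) \<partial>(\<Pi>\<^sub>M i\<in>A. L (I i)) \<partial>L k) =
        (\<integral>\<^sup>+\<omega>. f \<omega> \<partial>(\<Pi>\<^sub>M i\<in>insert a A. L ((I(a := k)) i)))"
      by (simp only: PI.product_nn_integral_insert_rev[OF insert.hyps fL] fun_upd_same)
  qed
  also have "\<dots> = (\<Sum>(k, I)\<in>K \<times> (A \<rightarrow>\<^sub>E K). \<integral>\<^sup>+\<omega>. f \<omega> \<partial>(\<Pi>\<^sub>M i\<in>insert a A. L ((I(a := k)) i)))"
    by (rule sum.cartesian_product)
  \<comment> \<open>Maps on \<open>insert a A\<close> correspond to pairs of a value at
    \<open>a\<close> and a map on \<open>A\<close>.\<close>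
  also have "\<dots> = (\<Sum>I\<in>insert a A \<rightarrow>\<^sub>E K. \<integral>\<^sup>+\<omega>. f \<omega> \<partial>(\<Pi>\<^sub>M i\<in>insert a A. L (I i)))"
    unfolding PiE_insert_eq
    by (subst sum.reindex[OF inj_combinator[OF insert.hyps(2)]]) (simp add: case_prod_unfold)
  finally show ?case .
qed

text \<open>Only one summand is kept for each index drawn by the sampling map, so that the remaining sum has
  the law of the subsum over the drawn indices.\<close>
lemma nn_integral_linf_sum_range_le:
  fixes L :: "'k \<Rightarrow> (real^'p::finite) measure" and I :: "'i \<Rightarrow> 'k"
  assumes L: "\<And>k. law_mean0 (L k)" and fin: "finite A" "finite J"
  shows "(\<integral>\<^sup>+\<omega>. ennreal (linf (\<Sum>j\<in>J. (if j \<in> I ` A then 1 else 0) *\<^sub>R \<omega> j)) \<partial>PiM J L) \<le>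
    (\<integral>\<^sup>+\<omega>. ennreal (linf (\<Sum>i\<in>A. \<omega> i)) \<partial>(\<Pi>\<^sub>M i\<in>A. L (I i)))"
proof -
  obtain R where R: "R \<subseteq> {i \<in> A. I i \<in> J}" "inj_on I R" "I ` {i \<in> A. I i \<in> J} = I ` R"
    using subset_image_inj[of "I ` {i \<in> A. I i \<in> J}" I "{i \<in> A. I i \<in> J}"] by blast
  have IR: "I ` R = J \<inter> I ` A" using R(3)[symmetric] by auto
  have meas: "(\<lambda>\<omega>. ennreal (linf (\<Sum>i\<in>R. \<omega> i))) \<in> borel_measurable (\<Pi>\<^sub>M i\<in>R. L (I i))"
    using borel_measurable_sum_PiM[of R "\<lambda>i. L (I i)" R] sets_law_mean0[OF L] by measurable
  have eq: "(\<Sum>j\<in>J. (if j \<in> I ` A then 1 else 0) *\<^sub>R \<omega> j) = (\<Sum>i\<in>R. restrict (\<lambda>i. \<omega> (I i)) R i)"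
    for \<omega> :: "'k \<Rightarrow> real^'p"
  proof -
    have "(\<Sum>j\<in>J. (if j \<in> I ` A then 1 else 0) *\<^sub>R \<omega> j) = (\<Sum>j\<in>J. if j \<in> I ` A then \<omega> j else 0)"
      by (intro sum.cong) auto
    also have "\<dots> = (\<Sum>j\<in>I ` R. \<omega> j)"
      unfolding IR by (rule sum.inter_restrict[OF fin(2), symmetric])
    also have "\<dots> = (\<Sum>i\<in>R. \<omega> (I i))" by (simp add: sum.reindex[OF R(2)])
    finally show ?thesis by simp
  qed
  have "(\<integral>\<^sup>+\<omega>. ennreal (linf (\<Sum>j\<in>J. (if j \<in> I ` A then 1 else 0) *\<^sub>R \<omega> j)) \<partial>PiM J L) =
      (\<integral>\<^sup>+\<omega>. ennreal (linf (\<Sum>i\<in>R. \<omega> i)) \<partial>(\<Pi>\<^sub>M i\<in>R. L (I i)))"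
    unfolding eq
    using R IR by (intro nn_integral_PiM_reindex[symmetric] meas prob_space_law_mean0[OF L]) auto
  also have "\<dots> \<le> (\<integral>\<^sup>+\<omega>. ennreal (linf (\<Sum>i\<in>A. \<omega> i)) \<partial>(\<Pi>\<^sub>M i\<in>A. L (I i)))"
    using R fin by (intro nn_integral_linf_sum_mono L) auto
  finally show ?thesis .
qed

text \<open>Counted by complement: a map misses \<open>j\<close> exactly when it takes values in
  \<open>K - {j}\<close>.\<close>

lemma card_PiE_hitting:
  assumes "finite A" "finite K" "j \<in> K"
  shows "card {I \<in> A \<rightarrow>\<^sub>E K. j \<in> I ` A} = card K ^ card A - (card K - 1) ^ card A"
proof -
  have "{I \<in> A \<rightarrow>\<^sub>E K. j \<in> I ` A} = (A \<rightarrow>\<^sub>E K) - (A \<rightarrow>\<^sub>E (K - {j}))"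
    by (auto simp: PiE_iff extensional_def)
  moreover have "(A \<rightarrow>\<^sub>E (K - {j})) \<subseteq> (A \<rightarrow>\<^sub>E K)" by (rule PiE_mono) auto
  ultimately show ?thesis
    using assms by (simp add: card_Diff_subset finite_PiE card_funcsetE)
qed

text \<open>Given the index map \<open>I\<close> of the sample, the sum over \<open>A\<close>
  dominates in expectation the sum over those \<open>j\<close> in \<open>J\<close> that were drawn.
  Averaging over \<open>I\<close> with the triangle inequality, every \<open>j\<close> is counted
  equally often, so the full sum over \<open>J\<close> reappears, scaled by the probability that a
  fixed index is drawn. All terms are multiplied by the number \<open>card K ^ card A\<close> of
  index maps.\<close>

lemma nn_integral_linf_sum_mixture:
  fixes L :: "'k \<Rightarrow> (real^'p::finite) measure" and A :: "'i set"
  assumes L: "\<And>k. law_mean0 (L k)" and Q: "prob_space Q" "sets Q = sets borel"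
    and K: "finite K" "J \<subseteq> K" and A: "finite A"
    and mix: "\<And>f. f \<in> borel_measurable borel \<Longrightarrow>
        of_nat (card K) * (\<integral>\<^sup>+x. f x \<partial>Q) = (\<Sum>k\<in>K. \<integral>\<^sup>+x. f x \<partial>L k)"
  shows "of_nat (card K ^ card A - (card K - 1) ^ card A) * (\<integral>\<^sup>+\<omega>. ennreal (linf (\<Sum>j\<in>J. \<omega> j)) \<partial>PiM J L)
    \<le> of_nat (card K ^ card A) * (\<integral>\<^sup>+\<omega>. ennreal (linf (\<Sum>i\<in>A. \<omega> i)) \<partial>PiM A (\<lambda>_. Q))"
proof -
  define c where "c = card K ^ card A - (card K - 1) ^ card A"
  let ?g = "\<lambda>I \<omega>. \<Sum>j\<in>J. (if j \<in> I ` A then 1 else 0) *\<^sub>R \<omega> j :: real^'p"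
  have J: "finite J" using K finite_subset by auto
  have fin: "finite (A \<rightarrow>\<^sub>E K)" using A K by (simp add: finite_PiE)
  have m1: "(\<lambda>\<omega>. linf (\<Sum>i\<in>A. \<omega> i)) \<in> borel_measurable (PiM A (\<lambda>_. borel :: (real^'p) measure))"
    using borel_measurable_sum_PiM[of A "\<lambda>_. borel" A] by measurable
  have m3: "(\<lambda>\<omega>. linf (\<Sum>j\<in>J. \<omega> j)) \<in> borel_measurable (PiM J L)"
    using borel_measurable_sum_PiM[of J L J] sets_law_mean0[OF L] by measurable
  have m2: "(\<lambda>\<omega>. linf (?g I \<omega>)) \<in> borel_measurable (PiM J L)" for I
  proof -
    have "?g I \<omega> = (\<Sum>j\<in>J \<inter> I ` A. \<omega> j)" for \<omega> :: "'k \<Rightarrow> real^'p"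
      unfolding sum.inter_restrict[OF J] by (intro sum.cong) auto
    then show ?thesis
      using borel_measurable_sum_PiM[of J L "J \<inter> I ` A"] sets_law_mean0[OF L] by measurable
  qed
  \<comment> \<open>Exchanging the sums leaves, for each \<open>j\<close>, the number of index maps
    that hit it, which is \<open>c\<close> for every \<open>j\<close>.\<close>
  have sum_g: "(\<Sum>I\<in>A \<rightarrow>\<^sub>E K. ?g I \<omega>) = real c *\<^sub>R (\<Sum>j\<in>J. \<omega> j)" for \<omega>
  proof -
    have "(\<Sum>I\<in>A \<rightarrow>\<^sub>E K. ?g I \<omega>) = (\<Sum>j\<in>J. \<Sum>I\<in>A \<rightarrow>\<^sub>E K. (if j \<in> I ` A then 1 else 0) *\<^sub>R \<omega> j)"
      by (rule sum.swap)
    also have "\<dots> = (\<Sum>j\<in>J. real c *\<^sub>R \<omega> j)"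
    proof (rule sum.cong[OF refl])
      fix j assume "j \<in> J"
      then have j: "j \<in> K" using K by auto
      have "(\<Sum>I\<in>A \<rightarrow>\<^sub>E K. if j \<in> I ` A then 1 else 0 :: real) = real (card {I \<in> A \<rightarrow>\<^sub>E K. j \<in> I ` A})"
        using fin by (simp add: sum.If_cases Int_def)
      also have "\<dots> = real c" by (simp only: card_PiE_hitting[OF A K(1) j] c_def)
      finally show "(\<Sum>I\<in>A \<rightarrow>\<^sub>E K. (if j \<in> I ` A then 1 else 0) *\<^sub>R \<omega> j) = real c *\<^sub>R \<omega> j"
        by (simp only: scaleR_left.sum[symmetric])
    qed
    finally show ?thesis by (simp only: scaleR_right.sum)
  qed
  have "of_nat c * (\<integral>\<^sup>+\<omega>. ennreal (linf (\<Sum>j\<in>J. \<omega> j)) \<partial>PiM J L)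
      = (\<integral>\<^sup>+\<omega>. of_nat c * ennreal (linf (\<Sum>j\<in>J. \<omega> j)) \<partial>PiM J L)"
    by (intro nn_integral_cmult[symmetric] measurable_compose[OF m3 measurable_ennreal])
  also have "\<dots> = (\<integral>\<^sup>+\<omega>. ennreal (linf (\<Sum>I\<in>A \<rightarrow>\<^sub>E K. ?g I \<omega>)) \<partial>PiM J L)"
    unfolding sum_g linf_scaleR by (simp add: ennreal_mult ennreal_of_nat_eq_real_of_nat[symmetric])
  also have "\<dots> \<le> (\<integral>\<^sup>+\<omega>. (\<Sum>I\<in>A \<rightarrow>\<^sub>E K. ennreal (linf (?g I \<omega>))) \<partial>PiM J L)"
    by (intro nn_integral_mono) (subst sum_ennreal, auto intro!: ennreal_leI linf_sum)
  also have "\<dots> = (\<Sum>I\<in>A \<rightarrow>\<^sub>E K. \<integral>\<^sup>+\<omega>. ennreal (linf (?g I \<omega>)) \<partial>PiM J L)"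
    by (intro nn_integral_sum measurable_compose[OF m2 measurable_ennreal])
  also have "\<dots> \<le> (\<Sum>I\<in>A \<rightarrow>\<^sub>E K. \<integral>\<^sup>+\<omega>. ennreal (linf (\<Sum>i\<in>A. \<omega> i)) \<partial>(\<Pi>\<^sub>M i\<in>A. L (I i)))"
    by (intro sum_mono nn_integral_linf_sum_range_le L A J)
  also have "\<dots> = of_nat (card K) ^ card A * (\<integral>\<^sup>+\<omega>. ennreal (linf (\<Sum>i\<in>A. \<omega> i)) \<partial>PiM A (\<lambda>_. Q))"
    by (intro measurable_compose[OF m1 measurable_ennreal] nn_integral_PiM_mixture[symmetric, where M=borel] mix L Q A
        prob_space_law_mean0 sets_law_mean0)
  finally show ?thesis by (simp add: c_def)
qed

section \<open>Lower bound\<close>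

text \<open>Each sign pattern is paired with the one that agrees with it at \<open>k\<close> only.
  The two signed sums add up to \<open>(2 * s k) *\<^sub>R x k\<close>, so by the triangle
  inequality every pair contributes at least \<open>2 * linf (x k)\<close>.\<close>

lemma linf_le_sum_signs:
  assumes A: "finite A" and k: "k \<in> A"
  shows "2 ^ card A * linf (x k) \<le> (\<Sum>s\<in>A \<rightarrow>\<^sub>E {-1, 1}. linf (\<Sum>i\<in>A. s i *\<^sub>R x i))"
proof -
  let ?S = "A \<rightarrow>\<^sub>E {-1, 1 :: real}"
  let ?F = "\<lambda>s. linf (\<Sum>i\<in>A. s i *\<^sub>R x i)"
  define flip where "flip s = (\<lambda>i\<in>A. if i = k then s i else - s i)" for s :: "'a \<Rightarrow> real"
  have flip: "flip s \<in> ?S" "flip (flip s) = s" if "s \<in> ?S" for s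
    using that by (auto simp: flip_def PiE_iff fun_eq_iff extensional_def)
  \<comment> \<open>\<open>flip\<close> is an involution on the sign patterns, so it permutes the
    summands.\<close>
  have "(\<Sum>s\<in>?S. ?F (flip s)) = (\<Sum>s\<in>?S. ?F s)"
    by (rule sum.reindex_bij_witness[of _ flip flip]) (auto simp: flip)
  moreover have "2 * linf (x k) \<le> ?F s + ?F (flip s)" if s: "s \<in> ?S" for s
  proof -
    have "(\<Sum>i\<in>A. s i *\<^sub>R x i) + (\<Sum>i\<in>A. flip s i *\<^sub>R x i) = (\<Sum>i\<in>A. if i = k then (2 * s k) *\<^sub>R x k else 0)"
      unfolding sum.distrib[symmetric]
      by (intro sum.cong) (auto simp: flip_def scaleR_left.add[symmetric])
    also have "\<dots> = (2 * s k) *\<^sub>R x k" using A k by simp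
    finally have "linf ((2 * s k) *\<^sub>R x k) \<le> ?F s + ?F (flip s)"
      using linf_triangle[of "\<Sum>i\<in>A. s i *\<^sub>R x i" "\<Sum>i\<in>A. flip s i *\<^sub>R x i"] by simp
    moreover have "\<bar>s k\<bar> = 1" using s k by (force simp: PiE_iff)
    ultimately show ?thesis by (simp add: linf_scaleR abs_mult)
  qed
  then have "(\<Sum>s\<in>?S. 2 * linf (x k)) \<le> (\<Sum>s\<in>?S. ?F s + ?F (flip s))" by (intro sum_mono)
  ultimately show ?thesis
    using A by (simp add: sum.distrib card_funcsetE)
qed

section \<open>Sign changes and comparison with the supremum over independent laws\<close>

lemma law_mean0_scaleR:
  assumes "law_mean0 P"
  shows "law_mean0 (distr P borel (\<lambda>x. a *\<^sub>R x))"
proof -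
  interpret prob_space P using assms by (rule prob_space_law_mean0)
  note [measurable_cong] = sets_law_mean0[OF assms]
  have [measurable]: "(\<lambda>x::real^'a. a *\<^sub>R x) \<in> borel_measurable borel" by measurable
  have "prob_space (distr P borel (\<lambda>x. a *\<^sub>R x))" by (rule prob_space_distr) measurable
  then show ?thesis
    using assms by (auto simp: law_mean0_def integrable_distr_eq integral_distr)
qed

lemma nn_integral_linf_mean:
  assumes "\<And>i. i < n \<Longrightarrow> law_mean0 (Ps i :: (real^'p::finite) measure)"
  shows "(\<integral>\<^sup>+\<omega>. ennreal (linf ((1 / real n) *\<^sub>R (\<Sum>i<n. \<omega> i))) \<partial>PiM {..<n} Ps) =
    ennreal (1 / real n) * (\<integral>\<^sup>+\<omega>. ennreal (linf (\<Sum>i<n. \<omega> i)) \<partial>PiM {..<n} Ps)"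
proof -
  have m: "(\<lambda>\<omega>. linf (\<Sum>i<n. \<omega> i)) \<in> borel_measurable (PiM {..<n} Ps)"
    using borel_measurable_sum_PiM[of "{..<n}" Ps "{..<n}"] assms sets_law_mean0 by measurable
  have "(\<integral>\<^sup>+\<omega>. ennreal (linf ((1 / real n) *\<^sub>R (\<Sum>i<n. \<omega> i))) \<partial>PiM {..<n} Ps) =
      (\<integral>\<^sup>+\<omega>. ennreal (1 / real n) * ennreal (linf (\<Sum>i<n. \<omega> i)) \<partial>PiM {..<n} Ps)"
    by (intro nn_integral_cong) (simp add: linf_scaleR ennreal_mult'[symmetric])
  also have "\<dots> = ennreal (1 / real n) * (\<integral>\<^sup>+\<omega>. ennreal (linf (\<Sum>i<n. \<omega> i)) \<partial>PiM {..<n} Ps)"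
    by (intro nn_integral_cmult measurable_compose[OF m measurable_ennreal])
  finally show ?thesis .
qed

lemma ennreal_inverse_of_nat_mult:
  assumes "n \<ge> 1"
  shows "ennreal (1 / real n) * (of_nat n * x) = x"
proof -
  have "ennreal (1 / real n) * of_nat n = 1"
    using assms by (simp add: ennreal_of_nat_eq_real_of_nat ennreal_mult[symmetric])
  then show ?thesis by (simp add: mult.assoc[symmetric])
qed

text \<open>A bound satisfied by every marginal is satisfied by the average, so any choice of laws
  from \<open>Pq\<close>, identical or not, competes in the supremum \<open>Eq\<close>.\<close>

lemma nn_integral_le_Eq:
  assumes n: "n \<ge> 1" and P: "\<And>i. i < n \<Longrightarrow> Ps i \<in> Pq t q \<sigma> B"
  shows "(\<integral>\<^sup>+\<omega>. ennreal (linf ((1 / real n) *\<^sub>R (\<Sum>i<n. \<omega> i))) \<partial>PiM {..<n} Ps) \<le> Eq t n q \<sigma> B"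
proof -
  have avg: "ennreal (1 / real n) * (\<Sum>i<n. f i) \<le> c" if "\<And>i. i < n \<Longrightarrow> f i \<le> c" for f c
  proof -
    have "(\<Sum>i<n. f i) \<le> (\<Sum>i<n. c)" using that by (intro sum_mono) auto
    then have "ennreal (1 / real n) * (\<Sum>i<n. f i) \<le> ennreal (1 / real n) * (of_nat n * c)"
      by (intro mult_left_mono) auto
    then show ?thesis using ennreal_inverse_of_nat_mult[OF n] by simp
  qed
  show ?thesis
    unfolding Eq_def using P
    by (intro SUP_upper CollectI conjI allI impI avg) (auto simp: Pq_def)
qed

lemma nn_integral_le_of_nat_mult_Eq:
  assumes n: "n \<ge> 1" and P: "\<And>i. i < n \<Longrightarrow> Ps i \<in> Pq t q \<sigma> B"
  shows "(\<integral>\<^sup>+\<omega>. ennreal (linf (\<Sum>i<n. \<omega> i)) \<partial>PiM {..<n} Ps) \<le> of_nat n * Eq t n q \<sigma> B"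
proof -
  let ?I = "\<integral>\<^sup>+\<omega>. ennreal (linf (\<Sum>i<n. \<omega> i)) \<partial>PiM {..<n} Ps"
  have "?I = of_nat n * (ennreal (1 / real n) * ?I)"
    using ennreal_inverse_of_nat_mult[OF n, of ?I] by (simp add: mult.left_commute)
  also have "ennreal (1 / real n) * ?I \<le> Eq t n q \<sigma> B"
    using nn_integral_le_Eq[OF assms] P by (subst nn_integral_linf_mean[symmetric]) (auto simp: Pq_def)
  finally show ?thesis by (simp add: mult_left_mono)
qed

lemma Estar_le_Eq:
  assumes "n \<ge> 1"
  shows "Estar t n q \<sigma> B b \<le> Eq t n q \<sigma> B"
  unfolding Estar_def by (intro SUP_least nn_integral_le_Eq assms) (auto simp: Pqinf_def)

lemma scaleR_sign_in_Pq:
  assumes "P \<in> Pq t q \<sigma> B" "s \<in> {-1, 1}"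
  shows "distr P borel (\<lambda>x. s *\<^sub>R x) \<in> Pq t q \<sigma> B"
proof -
  have P: "law_mean0 P" using assms by (simp add: Pq_def)
  note [measurable_cong] = sets_law_mean0[OF P]
  have "\<bar>s\<bar> = 1" "s\<^sup>2 = 1" using assms(2) by auto
  then show ?thesis
    using assms(1) P by (auto simp: Pq_def law_mean0_scaleR nn_integral_distr linf_scaleR power_mult_distrib)
qed

text \<open>Fixed signs can be absorbed into the marginals, which remain in \<open>Pq\<close> but
  may differ from each other; every signed sum is thus bounded by \<open>n\<close> times
  \<open>Eq\<close>. Averaging over the \<open>2 ^ n\<close> sign patterns bounds the
  maximum.\<close>

lemma Mq_le_Eq:
  assumes n: "n \<ge> 1"
  shows "Mq t n q \<sigma> B \<le> of_nat n * Eq t n q \<sigma> B"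
  unfolding Mq_def
proof (rule SUP_least)
  fix P assume P: "P \<in> Pq t q \<sigma> B"
  then have lP: "law_mean0 P" by (simp add: Pq_def)
  note [measurable_cong] = sets_law_mean0[OF lP]
  let ?S = "{..<n} \<rightarrow>\<^sub>E {-1, 1 :: real}"
  let ?P = "PiM {..<n} (\<lambda>_. P)"
  let ?D = "\<lambda>s. \<Pi>\<^sub>M i\<in>{..<n}. distr P borel (\<lambda>x. s i *\<^sub>R x)"
  have m: "(\<lambda>\<omega>. linf (\<Sum>i<n. s i *\<^sub>R \<omega> i)) \<in> borel_measurable ?P" for s
    by measurable
  have push: "(\<integral>\<^sup>+\<omega>. ennreal (linf (\<Sum>i<n. s i *\<^sub>R \<omega> i)) \<partial>?P) = (\<integral>\<^sup>+\<omega>. ennreal (linf (\<Sum>i<n. \<omega> i)) \<partial>?D s)" for s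
  proof -
    have "?D s = distr ?P (PiM {..<n} (\<lambda>_. borel)) (\<lambda>x. \<lambda>i\<in>{..<n}. s i *\<^sub>R x i)"
      by (rule PiM_distr_eq) (auto simp: prob_space_law_mean0[OF lP])
    then show ?thesis by (simp add: nn_integral_distr)
  qed
  \<comment> \<open>The index \<open>k\<close> attaining the maximum depends on the sample, which is
    harmless because the bound by the sum over signs holds pointwise for every
    \<open>k\<close>.\<close>
  have pw: "2 ^ n * Max ((\<lambda>i. linf (\<omega> i)) ` {..<n}) \<le> (\<Sum>s\<in>?S. linf (\<Sum>i<n. s i *\<^sub>R \<omega> i))" for \<omega>
  proof -
    have "Max ((\<lambda>i. linf (\<omega> i)) ` {..<n}) \<in> (\<lambda>i. linf (\<omega> i)) ` {..<n}"
      using n by (intro Max_in) (auto simp: lessThan_empty_iff)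
    then obtain k where k: "k \<in> {..<n}" "Max ((\<lambda>i. linf (\<omega> i)) ` {..<n}) = linf (\<omega> k)" by blast
    show ?thesis unfolding k(2) using linf_le_sum_signs[OF finite_lessThan k(1), of \<omega>] by simp
  qed
  have "2 ^ n * (\<integral>\<^sup>+\<omega>. ennreal (Max ((\<lambda>i. linf (\<omega> i)) ` {..<n})) \<partial>?P)
      = (\<integral>\<^sup>+\<omega>. ennreal (2 ^ n * Max ((\<lambda>i. linf (\<omega> i)) ` {..<n})) \<partial>?P)"
    by (subst nn_integral_cmult[symmetric]) (auto simp: ennreal_mult' ennreal_power[symmetric])
  also have "\<dots> \<le> (\<integral>\<^sup>+\<omega>. (\<Sum>s\<in>?S. ennreal (linf (\<Sum>i<n. s i *\<^sub>R \<omega> i))) \<partial>?P)"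
    by (intro nn_integral_mono) (subst sum_ennreal, auto intro!: ennreal_leI pw)
  also have "\<dots> = (\<Sum>s\<in>?S. \<integral>\<^sup>+\<omega>. ennreal (linf (\<Sum>i<n. s i *\<^sub>R \<omega> i)) \<partial>?P)"
    by (intro nn_integral_sum measurable_compose[OF m measurable_ennreal])
  also have "\<dots> \<le> (\<Sum>s\<in>?S. of_nat n * Eq t n q \<sigma> B)"
    unfolding push
    by (intro sum_mono nn_integral_le_of_nat_mult_Eq[OF n] scaleR_sign_in_Pq[OF P]) (auto simp: PiE_iff)
  also have "\<dots> = 2 ^ n * (of_nat n * Eq t n q \<sigma> B)"
    by (simp add: card_funcsetE)
  finally show "(\<integral>\<^sup>+\<omega>. ennreal (Max ((\<lambda>i. linf (\<omega> i)) ` {..<n})) \<partial>?P) \<le> of_nat n * Eq t n q \<sigma> B"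
    by (subst (asm) ennreal_mult_le_mult_iff) (auto simp: power_eq_top_ennreal)
qed

lemma Mq'_le_Mq:
  assumes n: "n \<ge> 1"
  shows "Mq' t n q \<sigma> B \<le> Mq t n q \<sigma> B"
  unfolding Mq'_def Mq_def
proof (rule SUP_mono')
  fix P :: "(real^'a) measure"
  have "Max ((\<lambda>i. linf (\<omega> i) * (if linf (\<omega> i) > tau t n q \<sigma> B then 1 else 0)) ` {..<n})
      \<le> Max ((\<lambda>i. linf (\<omega> i)) ` {..<n})" for \<omega> :: "nat \<Rightarrow> real^'a"
    using n by (intro Max.boundedI) (auto simp: lessThan_empty_iff intro!: Max_ge_iff[THEN iffD2])
  then show "(\<integral>\<^sup>+\<omega>. ennreal (Max ((\<lambda>i. linf (\<omega> i) *
            (if linf (\<omega> i) > tau t n q \<sigma> B then 1 else 0)) ` {..<n})) \<partial>PiM {..<n} (\<lambda>_. P))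
      \<le> (\<integral>\<^sup>+\<omega>. ennreal (Max ((\<lambda>i. linf (\<omega> i)) ` {..<n})) \<partial>PiM {..<n} (\<lambda>_. P))"
    by (intro nn_integral_mono ennreal_leI)
qed

section \<open>Reduction to symmetric i.i.d. vectors\<close>

text \<open>Invariance under reflection makes each coordinate mean equal to its negative. Finiteness
  of the first moments is assumed separately because \<open>law_mean0\<close> asks for
  integrability.\<close>

lemma law_mean0_symmetric:
  assumes Q: "prob_space Q" "sets Q = sets borel" and sym: "distr Q borel uminus = Q"
    and fin: "\<And>j. (\<integral>\<^sup>+x. ennreal \<bar>x $ j\<bar> \<partial>Q) < \<infinity>"
  shows "law_mean0 (Q :: (real^'p::finite) measure)"
proof -
  note [measurable_cong] = Q(2)
  have int: "integrable Q (\<lambda>x. x $ j)" for j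
    using fin by (intro integrableI_bounded) auto
  have "(\<integral>x. x $ j \<partial>Q) = 0" for j
  proof -
    have "(\<integral>x. x $ j \<partial>Q) = (\<integral>x. x $ j \<partial>distr Q borel uminus)" by (simp only: sym)
    also have "\<dots> = (\<integral>x. (- x) $ j \<partial>Q)" by (rule integral_distr) measurable
    finally show ?thesis by simp
  qed
  then show ?thesis using Q int by (simp add: law_mean0_def)
qed

text \<open>The mixture is realised by drawing an index uniformly from \<open>K\<close> and then
  sampling from its law, that is, as a monadic bind.\<close>

lemma ex_uniform_mixture:
  assumes K: "finite K" "K \<noteq> {}" and L: "\<And>k. prob_space (L k)" "\<And>k. sets (L k) = sets M"
  obtains Q where "prob_space Q" "sets Q = sets M"
    "\<And>f. f \<in> borel_measurable M \<Longrightarrow> of_nat (card K) * (\<integral>\<^sup>+x. f x \<partial>Q) = (\<Sum>k\<in>K. \<integral>\<^sup>+x. f x \<partial>L k)"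
proof
  let ?Q = "measure_pmf (pmf_of_set K) \<bind> L"
  have L': "L \<in> measure_pmf (pmf_of_set K) \<rightarrow>\<^sub>M subprob_algebra M"
    using L by (auto simp: space_subprob_algebra prob_space_imp_subprob_space)
  show "prob_space ?Q"
    by (intro prob_space.prob_space_bind[OF prob_space_measure_pmf _ L']) (auto simp: L)
  show "sets ?Q = sets M" by (rule sets_bind) (auto simp: L)
  fix f :: "_ \<Rightarrow> ennreal" assume "f \<in> borel_measurable M"
  then have "(\<integral>\<^sup>+x. f x \<partial>?Q) = (\<Sum>k\<in>K. \<integral>\<^sup>+x. f x \<partial>L k) / of_nat (card K)"
    using K by (simp add: nn_integral_bind[OF _ L'] nn_integral_pmf_of_set)
  moreover have "card K \<noteq> 0" using K by simp
  ultimately show "of_nat (card K) * (\<integral>\<^sup>+x. f x \<partial>?Q) = (\<Sum>k\<in>K. \<integral>\<^sup>+x. f x \<partial>L k)"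
    by (simp add: ennreal_times_divide mult.commute[of "of_nat (card K)"] ennreal_mult_divide_eq)
qed

text \<open>Bernoulli's inequality gives \<open>(2 * n / (2 * n - 1)) ^ n \<ge> 1 + n / (2 * n - 1)
  \<ge> 3 / 2\<close>, so a fixed one of \<open>2 * n\<close> indices is missed in all
  \<open>n\<close> draws with probability at most \<open>2 / 3\<close>.\<close>

lemma bernoulli_mixture_bound:
  assumes "n \<ge> 1"
  shows "(2 * n) ^ n \<le> 3 * ((2 * n) ^ n - (2 * n - 1) ^ n)"
proof -
  define m where "m = 2 * real n - 1"
  have m: "m \<ge> 1" using assms by (simp add: m_def)
  have "3 / 2 \<le> 1 + real n * (1 / m)" using m by (simp add: m_def field_simps)
  also have "\<dots> \<le> (1 + 1 / m) ^ n" using m by (intro Bernoulli_inequality) (auto intro: order_trans[of _ 0])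
  also have "1 + 1 / m = (2 * real n) / m" using m by (simp add: m_def field_simps)
  finally have "3 * m ^ n \<le> 2 * (2 * real n) ^ n" using m by (simp add: power_divide field_simps)
  moreover have "m = real (2 * n - 1)" using assms by (simp add: m_def of_nat_diff)
  ultimately have "real (3 * (2 * n - 1) ^ n) \<le> real (2 * (2 * n) ^ n)" by simp
  then have "3 * (2 * n - 1) ^ n \<le> 2 * (2 * n) ^ n" by (simp only: of_nat_le_iff)
  then show ?thesis by arith
qed

lemma ennreal_le_cancel_left:
  fixes a b c :: ennreal
  shows "c * a \<le> c * b \<Longrightarrow> c \<noteq> 0 \<Longrightarrow> c \<noteq> top \<Longrightarrow> a \<le> b"
  by (simp add: ennreal_mult_le_mult_iff)

lemma ennreal_eq_cancel_left:
  fixes a b c :: ennreal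
  shows "c * a = c * b \<Longrightarrow> c \<noteq> 0 \<Longrightarrow> c \<noteq> top \<Longrightarrow> a = b"
  by (intro antisym) (auto intro: ennreal_le_cancel_left[of c])

text \<open>The factor 3 comes from \<open>1 - (1 - 1 / (2 n)) ^ n \<ge> 1 / 3\<close>, a lower bound for the probability that
  a given one of the \<open>2 n\<close> mixed laws is drawn.\<close>
lemma ex_symmetric_iid_dominating:
  fixes t :: "'p::finite itself" and Ps :: "nat \<Rightarrow> (real^'p) measure"
  assumes n: "n \<ge> 1" and Ps: "\<And>i. i < n \<Longrightarrow> law_mean0 (Ps i)"
    and var: "\<And>j. ennreal (1 / real n) * (\<Sum>i<n. \<integral>\<^sup>+x. ennreal ((x $ j)^2) \<partial>Ps i) \<le> ennreal (\<sigma>^2)"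
    and mom: "ennreal (1 / real n) * (\<Sum>i<n. \<integral>\<^sup>+x. ennreal (linf x powr q) \<partial>Ps i) \<le> ennreal (B powr q)"
  obtains Q where "Q \<in> Pq t q \<sigma> B" "distr Q borel uminus = Q"
    "(\<integral>\<^sup>+\<omega>. ennreal (linf (\<Sum>i<n. \<omega> i)) \<partial>PiM {..<n} Ps) \<le>
      3 * (\<integral>\<^sup>+\<omega>. ennreal (linf (\<Sum>i<n. \<omega> i)) \<partial>PiM {..<n} (\<lambda>_. Q))"
proof -
  \<comment> \<open>Indices from \<open>n\<close> on get the law \<open>Ps 0\<close>, so that every
    index carries a centered law.\<close>
  define P where "P i = (if i < n then Ps i else Ps 0)" for i
  have P: "law_mean0 (P i)" for i using n Ps by (simp add: P_def)
  have P_Ps: "P i = Ps i" if "i < n" for i using that by (simp add: P_def)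
  \<comment> \<open>Component \<open>(i, s)\<close> of the mixture is \<open>P i\<close> multiplied
    by the sign \<open>s\<close>; both signs are included to make the mixture symmetric.\<close>
  define L where "L k = distr (P (fst k)) borel (\<lambda>x. snd k *\<^sub>R x)" for k :: "nat \<times> real"
  have L: "law_mean0 (L k)" for k unfolding L_def by (intro law_mean0_scaleR P)
  note [measurable_cong] = sets_law_mean0[OF P]
  define K where "K = {..<n} \<times> {1, -1 :: real}"
  have K: "finite K" "K \<noteq> {}" "card K = 2 * n"
    using n by (auto simp: K_def lessThan_empty_iff card_cartesian_product)
  obtain Q where Q: "prob_space Q" "sets Q = sets borel"
    and mix: "\<And>f. f \<in> borel_measurable borel \<Longrightarrow>
      of_nat (card K) * (\<integral>\<^sup>+x. f x \<partial>Q) = (\<Sum>k\<in>K. \<integral>\<^sup>+x. f x \<partial>L k)"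
    by (rule ex_uniform_mixture[of K L borel])
      (use K prob_space_law_mean0[OF L] sets_law_mean0[OF L] in auto)
  note [measurable_cong] = Q(2)
  have mix': "of_nat (2 * n) * (\<integral>\<^sup>+x. f x \<partial>Q) = (\<Sum>i<n. (\<integral>\<^sup>+x. f x \<partial>P i) + (\<integral>\<^sup>+x. f (- x) \<partial>P i))"
    if [measurable]: "f \<in> borel_measurable borel" for f
  proof -
    have "(\<Sum>k\<in>K. \<integral>\<^sup>+x. f x \<partial>L k) = (\<Sum>(i, s)\<in>K. \<integral>\<^sup>+x. f (s *\<^sub>R x) \<partial>P i)"
      by (intro sum.cong) (auto simp: L_def nn_integral_distr)
    also have "\<dots> = (\<Sum>i<n. \<Sum>s\<in>{1, -1}. \<integral>\<^sup>+x. f (s *\<^sub>R x) \<partial>P i)"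
      unfolding K_def by (rule sum.cartesian_product[symmetric])
    finally show ?thesis using mix[OF that] K by simp
  qed
  have nz: "of_nat (2 * n) \<noteq> (0 :: ennreal)" "of_nat (2 * n) \<noteq> (top :: ennreal)"
    using n by (simp, simp only: ennreal_of_nat_eq_real_of_nat ennreal_neq_top not_False_eq_True)
  \<comment> \<open>Replacing \<open>f x\<close> by \<open>f (- x)\<close> only swaps the two terms
    for each \<open>i\<close> in \<open>mix'\<close>.\<close>
  have refl: "(\<integral>\<^sup>+x. f (- x) \<partial>Q) = (\<integral>\<^sup>+x. f x \<partial>Q)" if [measurable]: "f \<in> borel_measurable borel" for f
  proof (rule ennreal_eq_cancel_left[OF _ nz])
    have "(\<lambda>x. f (- x)) \<in> borel_measurable borel" by measurable
    from mix'[OF this] mix'[OF that]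
    show "of_nat (2 * n) * (\<integral>\<^sup>+x. f (- x) \<partial>Q) = of_nat (2 * n) * (\<integral>\<^sup>+x. f x \<partial>Q)"
      by (simp add: add.commute)
  qed
  have sym: "distr Q borel uminus = Q"
  proof (rule measure_eqI)
    fix A assume "A \<in> sets (distr Q borel uminus)"
    then have A: "A \<in> sets borel" by simp
    have "emeasure (distr Q borel uminus) A = (\<integral>\<^sup>+x. indicator A x \<partial>distr Q borel uminus)" using A by simp
    also have "\<dots> = (\<integral>\<^sup>+x. indicator A (- x) \<partial>Q)" using A by (intro nn_integral_distr) auto
    also have "\<dots> = (\<integral>\<^sup>+x. indicator A x \<partial>Q)" using A by (intro refl) auto
    also have "\<dots> = emeasure Q A" using A Q by simp
    finally show "emeasure (distr Q borel uminus) A = emeasure Q A" .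
  qed (simp add: Q)
  \<comment> \<open>On even functions a law and its reflection contribute equally, so
    \<open>Q\<close> integrates them like the plain average of the \<open>P i\<close>. The variance
    and moment budgets, both given by even functions, thus pass to \<open>Q\<close> without
    loss.\<close>
  have even: "(\<integral>\<^sup>+x. g x \<partial>Q) = ennreal (1 / real n) * (\<Sum>i<n. \<integral>\<^sup>+x. g x \<partial>P i)"
    if g: "g \<in> borel_measurable borel" "\<And>x. g (- x) = g x" for g
  proof -
    have "2 * (of_nat n * (\<integral>\<^sup>+x. g x \<partial>Q)) = 2 * (\<Sum>i<n. \<integral>\<^sup>+x. g x \<partial>P i)"
      using mix'[OF g(1)] by (simp add: g(2) mult_2[symmetric] sum_distrib_left[symmetric] mult.assoc)
    then have "of_nat n * (\<integral>\<^sup>+x. g x \<partial>Q) = (\<Sum>i<n. \<integral>\<^sup>+x. g x \<partial>P i)"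
      by (rule ennreal_eq_cancel_left) auto
    then show ?thesis using ennreal_inverse_of_nat_mult[OF n] by metis
  qed
  have lQ: "law_mean0 Q"
  proof (rule law_mean0_symmetric[OF Q sym])
    fix j
    have "(\<integral>\<^sup>+x. ennreal \<bar>x $ j\<bar> \<partial>P i) < \<infinity>" for i
      using P[of i] by (simp add: law_mean0_def integrable_iff_bounded)
    then show "(\<integral>\<^sup>+x. ennreal \<bar>x $ j\<bar> \<partial>Q) < \<infinity>"
      by (subst even) (auto simp: ennreal_mult_less_top)
  qed
  have le: "(\<integral>\<^sup>+\<omega>. ennreal (linf (\<Sum>i<n. \<omega> i)) \<partial>PiM {..<n} Ps) \<le>
      3 * (\<integral>\<^sup>+\<omega>. ennreal (linf (\<Sum>i<n. \<omega> i)) \<partial>PiM {..<n} (\<lambda>_. Q))" (is "?IP \<le> 3 * ?IQ")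
  proof -
    \<comment> \<open>Only the unreflected copies are kept; they are \<open>n\<close> of the
      \<open>2 * n\<close> components and have the laws \<open>P i\<close>.\<close>
    let ?J = "{..<n} \<times> {1 :: real}"
    have JK: "?J \<subseteq> K" by (auto simp: K_def)
    have L1: "L (i, 1) = P i" for i
    proof -
      have "distr (P i) borel (\<lambda>x. x) = P i" by (rule distr_id2) (simp add: sets_law_mean0[OF P])
      then show ?thesis by (simp add: L_def)
    qed
    have m: "(\<lambda>\<omega>. linf (\<Sum>i<n. \<omega> i)) \<in> borel_measurable (\<Pi>\<^sub>M i\<in>{..<n}. L (i, 1))"
      using borel_measurable_sum_PiM[of "{..<n}" "\<lambda>i. L (i, 1)" "{..<n}"] sets_law_mean0[OF L] by measurable
    have "(\<Sum>k\<in>?J. \<omega> k) = (\<Sum>i<n. \<omega> (i, 1))" for \<omega> :: "nat \<times> real \<Rightarrow> real^'p"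
      by (rule sum.reindex_bij_witness[of _ "\<lambda>i. (i, 1)" fst]) auto
    moreover have "?IP = (\<integral>\<^sup>+\<omega>. ennreal (linf (\<Sum>i<n. \<omega> i)) \<partial>(\<Pi>\<^sub>M i\<in>{..<n}. L (i, 1)))"
      by (intro nn_integral_cong_simp arg_cong2[where f=nn_integral] PiM_cong) (auto simp: L1 P_Ps)
    moreover have "\<dots> = (\<integral>\<^sup>+\<omega>. ennreal (linf (\<Sum>i<n. restrict (\<lambda>i. \<omega> (i, 1)) {..<n} i)) \<partial>PiM ?J L)"
      by (intro nn_integral_PiM_reindex measurable_compose[OF m measurable_ennreal] prob_space_law_mean0 L)
        (auto intro: inj_onI)
    ultimately have IP: "?IP = (\<integral>\<^sup>+\<omega>. ennreal (linf (\<Sum>k\<in>?J. \<omega> k)) \<partial>PiM ?J L)" by simp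
    \<comment> \<open>Everything is multiplied by the number \<open>(2 * n) ^ n\<close> of index
      maps, which is cancelled at the end.\<close>
    have "of_nat ((2 * n) ^ n) * ?IP \<le> of_nat (3 * ((2 * n) ^ n - (2 * n - 1) ^ n)) * ?IP"
      by (intro mult_right_mono) (use bernoulli_mixture_bound[OF n] in \<open>simp only: of_nat_mono\<close>, simp)
    also have "\<dots> = 3 * (of_nat ((2 * n) ^ n - (2 * n - 1) ^ n) * ?IP)"
      by (simp only: of_nat_mult of_nat_numeral mult.assoc)
    also have "\<dots> \<le> 3 * (of_nat ((2 * n) ^ n) * ?IQ)"
    proof (rule mult_left_mono)
      show "of_nat ((2 * n) ^ n - (2 * n - 1) ^ n) * ?IP \<le> of_nat ((2 * n) ^ n) * ?IQ"
        using nn_integral_linf_sum_mixture[OF L Q K(1) JK finite_lessThan mix, of n]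
        unfolding IP K(3) card_lessThan .
    qed simp
    also have "\<dots> = of_nat ((2 * n) ^ n) * (3 * ?IQ)" by (rule mult.left_commute)
    finally show ?thesis
      by (rule ennreal_le_cancel_left)
        (use n in simp, simp only: ennreal_of_nat_eq_real_of_nat ennreal_neq_top not_False_eq_True)
  qed
  have "(\<integral>\<^sup>+x. ennreal ((x $ j)^2) \<partial>Q) \<le> ennreal (\<sigma>^2)" for j
    using var[of j] by (subst even) (simp_all add: P_Ps)
  moreover have "(\<integral>\<^sup>+x. ennreal (linf x powr q) \<partial>Q) \<le> ennreal (B powr q)"
    using mom by (subst even) (simp_all add: P_Ps)
  ultimately have "Q \<in> Pq t q \<sigma> B" using lQ by (simp add: Pq_def)
  then show ?thesis using sym le by (rule that)
qed

section \<open>Truncation and exceedances\<close>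

text \<open>Markov's inequality for the moment of order \<open>q\<close> bounds the exceedance
  probability at level \<open>8 * n * B\<close> by
  \<open>(8 * n) powr (- q) \<le> 1 / (8 * n)\<close>, so the set defining the infimum is nonempty.
  The last claim says that the infimum is attained, by continuity of the measure from below.\<close>

lemma Tthr_bounds:
  assumes P: "P \<in> Pq t q \<sigma> B" and q: "q \<ge> 1" and n: "n \<ge> 1" and B: "B \<ge> 0"
  shows "0 \<le> Tthr P n" "Tthr P n \<le> 8 * real n * B"
    "measure P {x. linf x > Tthr P n} \<le> 1 / (8 * real n)"
proof -
  let ?S = "{t. t \<ge> 0 \<and> measure P {x. linf x > t} \<le> 1 / (8 * real n)}"
  let ?b = "8 * real n * B"
  have lP: "law_mean0 P" and mom: "(\<integral>\<^sup>+x. ennreal (linf x powr q) \<partial>P) \<le> ennreal (B powr q)"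
    using P by (auto simp: Pq_def)
  interpret prob_space P by (rule prob_space_law_mean0[OF lP])
  note [measurable_cong] = sets_law_mean0[OF lP]
  have space: "space P = UNIV" using sets_eq_imp_space_eq[OF sets_law_mean0[OF lP]] by simp
  have meas: "{x. linf x > t} \<in> sets P" for t
    using measurable_sets[of linf P borel "{t<..}"] space by (auto simp: vimage_def)
  have b: "?b \<in> ?S"
  \<comment> \<open>For \<open>B = 0\<close> the level \<open>8 * n * B\<close> vanishes and
    Markov's inequality cannot be applied at it; instead the vector is zero almost surely.\<close>
  proof (cases "B = 0")
    case True
    then have "(\<integral>\<^sup>+x. ennreal (linf x powr q) \<partial>P) = 0" using mom by simp
    then have "AE x in P. linf x powr q = 0"
      by (subst (asm) nn_integral_0_iff_AE) auto
    then have "AE x in P. \<not> linf x > 0" by eventually_elim auto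
    then have "prob {x. linf x > 0} = 0"
      using AE_iff_measurable[OF meas[of 0]] space by (auto simp: measure_def)
    then show ?thesis using True by simp
  next
    case False
    then have B0: "B > 0" using B by simp
    then have b0: "?b > 0" using n by simp
    have "emeasure P {x. linf x > ?b} \<le> emeasure P {x \<in> space P. 1 \<le> ennreal (?b powr (- q)) * ennreal (linf x powr q)}"
    proof (rule emeasure_mono)
      show "{x. linf x > ?b} \<subseteq> {x \<in> space P. 1 \<le> ennreal (?b powr (- q)) * ennreal (linf x powr q)}"
      proof (safe)
        fix x assume x: "linf x > ?b"
        have "?b powr q \<noteq> 0" using b0 by (metis less_irrefl powr_eq_0_iff)
        then have "1 = ?b powr (- q) * ?b powr q" unfolding powr_minus by (rule left_inverse[symmetric])
        also have "\<dots> \<le> ?b powr (- q) * linf x powr q"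
          using x b0 q by (intro mult_left_mono powr_mono2) auto
        finally show "1 \<le> ennreal (?b powr (- q)) * ennreal (linf x powr q)"
          by (simp add: ennreal_mult'[symmetric])
      qed (simp add: space)
    qed measurable
    also have "\<dots> \<le> ennreal (?b powr (- q)) * (\<integral>\<^sup>+x. ennreal (linf x powr q) * indicator (space P) x \<partial>P)"
      by (rule nn_integral_Markov_inequality) auto
    also have "\<dots> \<le> ennreal (?b powr (- q)) * ennreal (B powr q)"
      using mom by (intro mult_left_mono) (auto simp: space)
    also have "\<dots> = ennreal ((8 * real n) powr (- q))"
      using B0 by (simp add: ennreal_mult'[symmetric] powr_mult powr_minus)
    also have "\<dots> \<le> ennreal ((8 * real n) powr (- 1))"
      using q n by (intro ennreal_leI powr_mono) auto
    also have "(8 * real n) powr (- 1) = 1 / (8 * real n)"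
      using n by (intro powr_neg_one) simp
    finally have "prob {x. linf x > ?b} \<le> 1 / (8 * real n)"
      by (simp add: emeasure_eq_measure)
    then show ?thesis using b0 by simp
  qed
  have bdd: "bdd_below ?S" by (rule bdd_belowI[of _ 0]) auto
  show "0 \<le> Tthr P n" unfolding Tthr_def by (rule cInf_greatest) (use b in blast, simp)
  show "Tthr P n \<le> ?b" unfolding Tthr_def by (rule cInf_lower[OF b bdd])
  \<comment> \<open>Every level strictly above the infimum lies above some admissible
    \<open>u\<close>; the increments \<open>1 / Suc k\<close> provide a sequence of such
    levels.\<close>
  have eps: "prob {x. linf x > Tthr P n + 1 / real (Suc k)} \<le> 1 / (8 * real n)" for k
  proof -
    have "Inf ?S < Tthr P n + 1 / real (Suc k)" unfolding Tthr_def by simp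
    then obtain u where u: "u \<in> ?S" "u < Tthr P n + 1 / real (Suc k)"
      using cInf_lessD[of ?S] b by blast
    have "prob {x. linf x > Tthr P n + 1 / real (Suc k)} \<le> prob {x. linf x > u}"
      using u(2) by (intro finite_measure_mono meas) auto
    then show ?thesis using u(1) by simp
  qed
  have union: "(\<Union>k. {x. linf x > Tthr P n + 1 / real (Suc k)}) = {x. linf x > Tthr P n}" (is "?l = ?r")
  proof
    show "?r \<subseteq> ?l"
    proof
      fix x assume "x \<in> ?r"
      then have "linf x - Tthr P n > 0" by simp
      then obtain k where "inverse (real (Suc k)) < linf x - Tthr P n" by (rule reals_Archimedean[THEN exE])
      then show "x \<in> ?l" by (auto simp: divide_inverse algebra_simps intro!: exI[of _ k])
    qed
    show "?l \<subseteq> ?r" 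
    proof
      fix x assume "x \<in> ?l"
      then obtain k where "linf x > Tthr P n + 1 / real (Suc k)" by auto
      moreover have "1 / real (Suc k) > 0" by simp
      ultimately show "x \<in> ?r" unfolding mem_Collect_eq by linarith
    qed
  qed
  have "(\<lambda>k. prob {x. linf x > Tthr P n + 1 / real (Suc k)}) \<longlonglongrightarrow> prob (\<Union>k. {x. linf x > Tthr P n + 1 / real (Suc k)})"
  proof (rule finite_Lim_measure_incseq)
    show "range (\<lambda>k. {x. linf x > Tthr P n + 1 / real (Suc k)}) \<subseteq> events" using meas by auto
    show "incseq (\<lambda>k. {x. linf x > Tthr P n + 1 / real (Suc k)})"
    proof (rule incseq_SucI, rule Collect_mono, rule impI)
      fix k x assume "linf x > Tthr P n + 1 / real (Suc k)"
      moreover have "1 / real (Suc (Suc k)) \<le> 1 / real (Suc k)" by (simp add: frac_le)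
      ultimately show "linf x > Tthr P n + 1 / real (Suc (Suc k))" by linarith
    qed
  qed
  then show "prob {x. linf x > Tthr P n} \<le> 1 / (8 * real n)"
    unfolding union by (rule LIMSEQ_le_const2) (use eps in auto)
qed

lemma tau_properties:
  assumes P: "P \<in> Pq t q \<sigma> B" and q: "q \<ge> 1" and n: "n \<ge> 1" and B: "B \<ge> 0"
  shows "0 \<le> tau t n q \<sigma> B" "emeasure P {x. linf x > tau t n q \<sigma> B} \<le> ennreal (1 / (8 * real n))"
proof -
  \<comment> \<open>The bound \<open>8 * n * B\<close> is the same for all laws in
    \<open>Pq\<close>, so the supremum defining \<open>tau\<close> is taken over a bounded set of
    reals.\<close>
  have le: "Tthr P n \<le> tau t n q \<sigma> B"
    unfolding tau_def using P Tthr_bounds(2)[OF _ q n B]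
    by (intro cSup_upper bdd_aboveI[of _ "8 * real n * B"]) auto
  from le Tthr_bounds(1)[OF assms] show "0 \<le> tau t n q \<sigma> B" by simp
  have lP: "law_mean0 P" using P by (auto simp: Pq_def)
  interpret prob_space P by (rule prob_space_law_mean0[OF lP])
  have "{x. linf x > Tthr P n} \<in> sets P"
    by (simp add: sets_law_mean0[OF lP])
  then have "prob {x. linf x > tau t n q \<sigma> B} \<le> prob {x. linf x > Tthr P n}"
    using le by (intro finite_measure_mono) auto
  then show "emeasure P {x. linf x > tau t n q \<sigma> B} \<le> ennreal (1 / (8 * real n))"
    using Tthr_bounds(3)[OF assms] by (simp add: emeasure_eq_measure)
qed

text \<open>Truncation may destroy the zero mean of a general law. Here the truncation map commutes
  with reflection, so the truncated law is again symmetric and therefore centered. The moments can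
  only decrease, since values are replaced by zero.\<close>

lemma truncation_in_Pqinf:
  assumes P: "P \<in> Pq t q \<sigma> B" and sym: "distr P borel uminus = P" and b: "b \<ge> 0" and q: "q \<ge> 1"
  shows "distr P borel (\<lambda>x. if linf x \<le> b then x else 0) \<in> Pqinf t q \<sigma> B b"
proof -
  let ?W = "\<lambda>x :: real^'a. if linf x \<le> b then x else 0"
  let ?D = "distr P borel ?W"
  have lP: "law_mean0 P" using P by (auto simp: Pq_def)
  interpret prob_space P by (rule prob_space_law_mean0[OF lP])
  note [measurable_cong] = sets_law_mean0[OF lP]
  have [measurable]: "?W \<in> borel_measurable borel" by measurable
  have "law_mean0 ?D"
  proof (rule law_mean0_symmetric)
    show "prob_space ?D" by (rule prob_space_distr) measurable
    have "distr ?D borel uminus = distr P borel (\<lambda>x. - ?W x)"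
      by (subst distr_distr) (auto simp: comp_def)
    also have "\<dots> = distr P borel (\<lambda>x. ?W (- x))" by (rule distr_cong) auto
    also have "\<dots> = distr (distr P borel uminus) borel ?W"
      by (subst distr_distr) (auto simp: comp_def)
    finally show "distr ?D borel uminus = ?D" by (simp only: sym)
    fix j
    have "(\<integral>\<^sup>+x. ennreal \<bar>x $ j\<bar> \<partial>?D) = (\<integral>\<^sup>+x. ennreal \<bar>?W x $ j\<bar> \<partial>P)"
      by (rule nn_integral_distr) measurable
    also have "\<dots> \<le> (\<integral>\<^sup>+x. ennreal \<bar>x $ j\<bar> \<partial>P)" by (intro nn_integral_mono) auto
    also have "\<dots> < \<infinity>" using lP by (simp add: law_mean0_def integrable_iff_bounded)
    finally show "(\<integral>\<^sup>+x. ennreal \<bar>x $ j\<bar> \<partial>?D) < \<infinity>" .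
  qed simp
  moreover have "(\<integral>\<^sup>+x. ennreal ((x $ j)^2) \<partial>?D) \<le> ennreal (\<sigma>^2)" for j
  proof -
    have "(\<integral>\<^sup>+x. ennreal ((x $ j)^2) \<partial>?D) = (\<integral>\<^sup>+x. ennreal ((?W x $ j)^2) \<partial>P)"
      by (rule nn_integral_distr) measurable
    also have "\<dots> \<le> (\<integral>\<^sup>+x. ennreal ((x $ j)^2) \<partial>P)" by (intro nn_integral_mono) auto
    finally show ?thesis using P by (auto simp: Pq_def intro: order_trans)
  qed
  moreover have "(\<integral>\<^sup>+x. ennreal (linf x powr q) \<partial>?D) \<le> ennreal (B powr q)"
  proof -
    have "(\<integral>\<^sup>+x. ennreal (linf x powr q) \<partial>?D) = (\<integral>\<^sup>+x. ennreal (linf (?W x) powr q) \<partial>P)"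
      by (rule nn_integral_distr) measurable
    also have "\<dots> \<le> (\<integral>\<^sup>+x. ennreal (linf x powr q) \<partial>P)" by (intro nn_integral_mono) auto
    finally show ?thesis using P by (auto simp: Pq_def intro: order_trans)
  qed
  moreover have "emeasure ?D {x. linf x > b} = 0"
  proof -
    have "{x :: real^'a. linf x > b} \<in> sets borel" by measurable
    then have "emeasure ?D {x. linf x > b} = emeasure P (?W -` {x. linf x > b} \<inter> space P)"
      by (intro emeasure_distr) auto
    also have "?W -` {x. linf x > b} = {}" using b by auto
    finally show ?thesis by simp
  qed
  ultimately show ?thesis by (simp add: Pqinf_def Pq_def)
qed

section \<open>Sums of rare nonnegative terms compared with their maximum\<close>

text \<open>Every nonzero term other than the largest one coexists with the largest one.\<close>
lemma sum_le_Max_plus_pairs: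
  fixes z :: "'a \<Rightarrow> real"
  assumes A: "finite A" "A \<noteq> {}" and z: "\<And>i. i \<in> A \<Longrightarrow> 0 \<le> z i"
  shows "(\<Sum>i\<in>A. z i) \<le> Max (z ` A) + (\<Sum>i\<in>A. \<Sum>j\<in>A - {i}. z i * (if z j > 0 then 1 else 0))"
proof -
  have "Max (z ` A) \<in> z ` A" using A by (intro Max_in) auto
  then obtain k where k: "k \<in> A" "Max (z ` A) = z k" by auto
  have nn: "0 \<le> (\<Sum>j\<in>A - {i}. z i * (if z j > 0 then 1 else 0))" if "i \<in> A" for i
    using z that by (intro sum_nonneg) auto
  have "(\<Sum>i\<in>A - {k}. z i) \<le> (\<Sum>i\<in>A - {k}. \<Sum>j\<in>A - {i}. z i * (if z j > 0 then 1 else 0))"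
  proof (rule sum_mono)
    fix i assume i: "i \<in> A - {k}"
    have "z i \<le> z k" using A i by (subst k(2)[symmetric]) (auto intro: Max_ge)
    then have "z i \<le> z i * (if z k > 0 then 1 else 0)" by auto
    also have "\<dots> \<le> (\<Sum>j\<in>A - {i}. z i * (if z j > 0 then 1 else 0))"
      using z i k A by (intro member_le_sum[where f="\<lambda>j. z i * (if z j > 0 then 1 else 0)"]) auto
    finally show "z i \<le> (\<Sum>j\<in>A - {i}. z i * (if z j > 0 then 1 else 0))" .
  qed
  then show ?thesis
    using nn[OF k(1)] k(2) by (simp add: sum.remove[OF A(1) k(1)])
qed

text \<open>By independence the expectation of each cross term is at most \<open>1 / (8 * n)\<close>
  times that of \<open>Z\<close>, and there are fewer than \<open>n ^ 2\<close> such terms. Together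
  they amount to at most an eighth of the left-hand side, which is absorbed there.\<close>

lemma nn_integral_sum_le_Max:
  fixes Z :: "'a \<Rightarrow> real"
  assumes prob: "prob_space P" and n: "n \<ge> 1"
    and Z [measurable]: "Z \<in> borel_measurable P" and Z0: "\<And>x. 0 \<le> Z x"
    and fin: "(\<integral>\<^sup>+x. ennreal (Z x) \<partial>P) < \<infinity>"
    and rare: "emeasure P {x \<in> space P. Z x > 0} \<le> ennreal (1 / (8 * real n))"
  shows "of_nat n * (\<integral>\<^sup>+x. ennreal (Z x) \<partial>P) \<le>
    2 * (\<integral>\<^sup>+\<omega>. ennreal (Max ((\<lambda>i. Z (\<omega> i)) ` {..<n})) \<partial>PiM {..<n} (\<lambda>_. P))"
proof -
  let ?P = "PiM {..<n} (\<lambda>_. P)"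
  interpret product_prob_space "\<lambda>_::nat. P" by (rule product_prob_spaceI) (rule prob)
  let ?b = "\<lambda>x. if Z x > 0 then 1 else 0 :: real"
  let ?e = "\<integral>\<^sup>+x. ennreal (Z x) \<partial>P" and ?M = "\<integral>\<^sup>+\<omega>. ennreal (Max ((\<lambda>i. Z (\<omega> i)) ` {..<n})) \<partial>?P"
  have single: "(\<integral>\<^sup>+\<omega>. ennreal (Z (\<omega> i)) \<partial>?P) = ?e" if "i < n" for i
    using that prob by (subst nn_integral_PiM_component[where g="\<lambda>x. ennreal (Z x)"]) auto
  have b: "(\<integral>\<^sup>+x. ennreal (?b x) \<partial>P) \<le> ennreal (1 / (8 * real n))"
  proof -
    have "(\<integral>\<^sup>+x. ennreal (?b x) \<partial>P) = (\<integral>\<^sup>+x. indicator {x \<in> space P. Z x > 0} x \<partial>P)"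
      by (intro nn_integral_cong) (auto simp: indicator_def)
    also have "\<dots> = emeasure P {x \<in> space P. Z x > 0}" by (rule nn_integral_indicator) measurable
    finally show ?thesis using rare by simp
  qed
  have pair: "(\<integral>\<^sup>+\<omega>. ennreal (Z (\<omega> i) * ?b (\<omega> j)) \<partial>?P) \<le> ?e * ennreal (1 / (8 * real n))"
    if ij: "i < n" "j < n" "j \<noteq> i" for i j
  proof -
    \<comment> \<open>The factors at coordinates other than \<open>i\<close> and \<open>j\<close>
      are constantly one, which brings the pair into the form of a product over all
      coordinates.\<close>
    let ?f = "\<lambda>k x. if k = i then ennreal (Z x) else if k = j then ennreal (?b x) else 1"
    have "(\<Prod>k<n. ?f k (\<omega> k)) = ennreal (Z (\<omega> i) * ?b (\<omega> j))" for \<omega>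
    proof -
      have "(\<Prod>k<n. ?f k (\<omega> k)) = (\<Prod>k\<in>{i, j}. ?f k (\<omega> k))"
        using ij by (intro prod.mono_neutral_right) auto
      then show ?thesis using ij Z0 by (simp add: ennreal_mult')
    qed
    then have "(\<integral>\<^sup>+\<omega>. ennreal (Z (\<omega> i) * ?b (\<omega> j)) \<partial>?P) = (\<integral>\<^sup>+\<omega>. (\<Prod>k<n. ?f k (\<omega> k)) \<partial>?P)" by simp
    also have "\<dots> = (\<Prod>k<n. \<integral>\<^sup>+x. ?f k x \<partial>P)"
      by (rule product_nn_integral_prod) auto
    also have "\<dots> = (\<Prod>k\<in>{i, j}. \<integral>\<^sup>+x. ?f k x \<partial>P)"
      using ij prob_space.emeasure_space_1[OF prob] by (intro prod.mono_neutral_right) auto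
    also have "\<dots> = ?e * (\<integral>\<^sup>+x. ennreal (?b x) \<partial>P)" using ij by simp
    also have "\<dots> \<le> ?e * ennreal (1 / (8 * real n))" by (intro mult_left_mono b) simp
    finally show ?thesis .
  qed
  have "of_nat n * ?e = (\<Sum>i<n. \<integral>\<^sup>+\<omega>. ennreal (Z (\<omega> i)) \<partial>?P)" by (simp add: single)
  also have "\<dots> = (\<integral>\<^sup>+\<omega>. (\<Sum>i<n. ennreal (Z (\<omega> i))) \<partial>?P)"
    by (intro nn_integral_sum[symmetric]) measurable
  also have "\<dots> \<le> (\<integral>\<^sup>+\<omega>. ennreal (Max ((\<lambda>i. Z (\<omega> i)) ` {..<n})) +
      (\<Sum>i<n. \<Sum>j\<in>{..<n} - {i}. ennreal (Z (\<omega> i) * ?b (\<omega> j))) \<partial>?P)"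
  proof (rule nn_integral_mono)
    fix \<omega> :: "nat \<Rightarrow> 'a"
    have ne: "{..<n} \<noteq> {}" using n by (auto simp: lessThan_empty_iff)
    have "Max ((\<lambda>i. Z (\<omega> i)) ` {..<n}) \<ge> 0"
      using ne Z0 by (subst Max_ge_iff) auto
    then have "ennreal (Max ((\<lambda>i. Z (\<omega> i)) ` {..<n}) + (\<Sum>i<n. \<Sum>j\<in>{..<n} - {i}. Z (\<omega> i) * ?b (\<omega> j))) =
      ennreal (Max ((\<lambda>i. Z (\<omega> i)) ` {..<n})) + (\<Sum>i<n. \<Sum>j\<in>{..<n} - {i}. ennreal (Z (\<omega> i) * ?b (\<omega> j)))"
      using Z0 by (subst ennreal_plus) (auto simp: sum_nonneg sum_ennreal)
    moreover have "(\<Sum>i<n. ennreal (Z (\<omega> i))) = ennreal (\<Sum>i<n. Z (\<omega> i))" using Z0 by (simp add: sum_ennreal)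
    moreover have "ennreal (\<Sum>i<n. Z (\<omega> i)) \<le>
        ennreal (Max ((\<lambda>i. Z (\<omega> i)) ` {..<n}) + (\<Sum>i<n. \<Sum>j\<in>{..<n} - {i}. Z (\<omega> i) * ?b (\<omega> j)))"
      by (intro ennreal_leI sum_le_Max_plus_pairs finite_lessThan ne Z0)
    ultimately show "(\<Sum>i<n. ennreal (Z (\<omega> i))) \<le> ennreal (Max ((\<lambda>i. Z (\<omega> i)) ` {..<n})) +
      (\<Sum>i<n. \<Sum>j\<in>{..<n} - {i}. ennreal (Z (\<omega> i) * ?b (\<omega> j)))"
      by (simp only:)
  qed
  also have "\<dots> = ?M + (\<Sum>i<n. \<Sum>j\<in>{..<n} - {i}. \<integral>\<^sup>+\<omega>. ennreal (Z (\<omega> i) * ?b (\<omega> j)) \<partial>?P)"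
  proof -
    have mm: "(\<lambda>\<omega>. ennreal (Z (\<omega> i) * ?b (\<omega> j))) \<in> borel_measurable ?P" if "i < n" "j < n" for i j
    proof -
      have b_meas: "?b \<in> borel_measurable P" by measurable
      have "(\<lambda>\<omega>. ?b (\<omega> j)) \<in> borel_measurable ?P"
        by (rule measurable_compose[OF _ b_meas]) (rule measurable_component_singleton, use that in simp)
      moreover have "(\<lambda>\<omega>. Z (\<omega> i)) \<in> borel_measurable ?P"
        by (rule measurable_compose[OF _ Z]) (rule measurable_component_singleton, use that in simp)
      ultimately show ?thesis by (intro measurable_compose[OF _ measurable_ennreal] borel_measurable_times)
    qed
    have "(\<integral>\<^sup>+\<omega>. (\<Sum>i<n. \<Sum>j\<in>{..<n} - {i}. ennreal (Z (\<omega> i) * ?b (\<omega> j))) \<partial>?P) =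
        (\<Sum>i<n. \<integral>\<^sup>+\<omega>. (\<Sum>j\<in>{..<n} - {i}. ennreal (Z (\<omega> i) * ?b (\<omega> j))) \<partial>?P)"
      by (intro nn_integral_sum borel_measurable_sum mm) auto
    also have "\<dots> = (\<Sum>i<n. \<Sum>j\<in>{..<n} - {i}. \<integral>\<^sup>+\<omega>. ennreal (Z (\<omega> i) * ?b (\<omega> j)) \<partial>?P)"
      by (intro sum.cong refl nn_integral_sum mm) auto
    finally have *: "(\<integral>\<^sup>+\<omega>. (\<Sum>i<n. \<Sum>j\<in>{..<n} - {i}. ennreal (Z (\<omega> i) * ?b (\<omega> j))) \<partial>?P) = \<dots>" .
    show ?thesis
      unfolding *[symmetric]
    proof (intro nn_integral_add borel_measurable_sum mm)
      show "(\<lambda>\<omega>. ennreal (Max ((\<lambda>i. Z (\<omega> i)) ` {..<n}))) \<in> borel_measurable ?P" by measurable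
    qed auto
  qed
  also have "\<dots> \<le> ?M + (\<Sum>i<n. \<Sum>j\<in>{..<n} - {i}. ?e * ennreal (1 / (8 * real n)))"
    by (intro add_left_mono sum_mono pair) auto
  \<comment> \<open>The diagonal is filled in to get a plain count of \<open>n ^ 2\<close>
    terms.\<close>
  also have "\<dots> \<le> ?M + (\<Sum>i<n. \<Sum>j<n. ?e * ennreal (1 / (8 * real n)))"
    by (intro add_left_mono sum_mono sum_mono2) auto
  also have "(\<Sum>i<n. \<Sum>j<n. ?e * ennreal (1 / (8 * real n))) = of_nat n * ?e * ennreal (1 / 8)"
  proof -
    have eighth: "of_nat n * ennreal (1 / (8 * real n)) = ennreal (1 / 8)"
      using n by (simp add: ennreal_of_nat_eq_real_of_nat ennreal_mult[symmetric])
    show ?thesis unfolding eighth[symmetric] by (simp add: mult_ac)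
  qed
  finally have *: "of_nat n * ?e \<le> ?M + of_nat n * ?e * ennreal (1 / 8)" .
  \<comment> \<open>Absorbing the last term requires a finite left-hand side, which is where
    \<open>fin\<close> enters.\<close>
  obtain e where e: "of_nat n * ?e = ennreal e" "e \<ge> 0"
    using fin by (cases "of_nat n * ?e") (auto simp: ennreal_mult_eq_top_iff)
  show ?thesis
  proof (cases ?M)
    case (real m)
    then have "e \<le> m + e * (1 / 8)" using * e
      by (simp add: ennreal_mult[symmetric] ennreal_plus[symmetric] del: ennreal_plus)
    \<comment> \<open>The inequality amounts to \<open>e \<le> (8 / 7) * m\<close>, rounded up to
      the factor 2.\<close>
    then have "e \<le> 2 * m" using e by simp
    then show ?thesis using e real by (simp add: ennreal_mult'[symmetric] ennreal_leI flip: ennreal_numeral)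
  qed (simp add: ennreal_mult_top)
qed

section \<open>Upper bound\<close>

text \<open>The maximum norm is at most the sum of the absolute coordinates, each of which is
  integrable.\<close>

lemma nn_integral_linf_finite:
  assumes "law_mean0 (P :: (real^'p::finite) measure)"
  shows "(\<integral>\<^sup>+x. ennreal (linf x) \<partial>P) < \<infinity>"
proof -
  note [measurable_cong] = sets_law_mean0[OF assms]
  have "linf x \<le> (\<Sum>j\<in>UNIV. \<bar>x $ j\<bar>)" for x :: "real^'p"
  proof -
    obtain j where "linf x = \<bar>x $ j\<bar>" using linf_attained by blast
    then show ?thesis using member_le_sum[of j UNIV "\<lambda>j. \<bar>x $ j\<bar>"] by simp
  qed
  then have "(\<integral>\<^sup>+x. ennreal (linf x) \<partial>P) \<le> (\<integral>\<^sup>+x. (\<Sum>j\<in>UNIV. ennreal \<bar>x $ j\<bar>) \<partial>P)"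
    by (intro nn_integral_mono) (subst sum_ennreal, auto intro: ennreal_leI)
  also have "\<dots> = (\<Sum>j\<in>UNIV. \<integral>\<^sup>+x. ennreal \<bar>x $ j\<bar> \<partial>P)"
    by (intro nn_integral_sum) measurable
  also have "\<dots> < \<infinity>"
    using assms by (auto simp: law_mean0_def integrable_iff_bounded)
  finally show ?thesis .
qed

text \<open>Every sample vector splits into its truncation at \<open>tau\<close> and its exceedance.
  The truncated law competes in \<open>Estar\<close>; the norms of the exceedances are summed and
  compared with their maximum, which competes in \<open>Mq'\<close>.\<close>

lemma nn_integral_symmetric_le:
  assumes Q: "Q \<in> Pq t q \<sigma> B" and sym: "distr Q borel uminus = Q"
    and q: "q \<ge> 1" and n: "n \<ge> 1" and B: "B \<ge> 0"
  shows "(\<integral>\<^sup>+\<omega>. ennreal (linf (\<Sum>i<n. \<omega> i)) \<partial>PiM {..<n} (\<lambda>_. Q)) \<le>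
    of_nat n * Estar t n q \<sigma> B (tau t n q \<sigma> B) + 2 * Mq' t n q \<sigma> B"
proof -
  let ?\<tau> = "tau t n q \<sigma> B"
  let ?P = "PiM {..<n} (\<lambda>_. Q)"
  define W where "W x = (if linf x \<le> ?\<tau> then x else 0)" for x :: "real^'a"
  define Z where "Z x = linf x * (if linf x > ?\<tau> then 1 else 0)" for x :: "real^'a"
  let ?D = "distr Q borel W"
  have lQ: "law_mean0 Q" using Q by (auto simp: Pq_def)
  note [measurable_cong] = sets_law_mean0[OF lQ]
  have [measurable]: "W \<in> borel_measurable borel" "Z \<in> borel_measurable borel"
    unfolding W_def[abs_def] Z_def[abs_def] by measurable
  have Z0 [simp]: "0 \<le> Z x" for x by (simp add: Z_def)
  have D: "?D \<in> Pqinf t q \<sigma> B ?\<tau>"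
    unfolding W_def[abs_def] by (rule truncation_in_Pqinf[OF Q sym tau_properties(1)[OF Q q n B] q])
  then have lD: "law_mean0 ?D" by (auto simp: Pqinf_def Pq_def)
  have m: "(\<lambda>\<omega>. linf (\<Sum>i<n. \<omega> i)) \<in> borel_measurable (PiM {..<n} (\<lambda>_. borel :: (real^'a) measure))"
    by measurable
  have "linf (\<Sum>i<n. \<omega> i) \<le> linf (\<Sum>i<n. W (\<omega> i)) + (\<Sum>i<n. Z (\<omega> i))" for \<omega> :: "nat \<Rightarrow> real^'a"
  proof -
    have "linf (\<Sum>i<n. \<omega> i) \<le> linf (\<Sum>i<n. W (\<omega> i)) + linf (\<Sum>i<n. \<omega> i - W (\<omega> i))"
      using linf_triangle[of "\<Sum>i<n. W (\<omega> i)" "\<Sum>i<n. \<omega> i - W (\<omega> i)"]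
      by (simp add: sum_subtractf)
    also have "linf (\<Sum>i<n. \<omega> i - W (\<omega> i)) \<le> (\<Sum>i<n. linf (\<omega> i - W (\<omega> i)))" by (rule linf_sum)
    also have "\<dots> = (\<Sum>i<n. Z (\<omega> i))" by (intro sum.cong) (auto simp: W_def Z_def)
    finally show ?thesis by simp
  qed
  then have le: "ennreal (linf (\<Sum>i<n. \<omega> i)) \<le> ennreal (linf (\<Sum>i<n. W (\<omega> i))) + (\<Sum>i<n. ennreal (Z (\<omega> i)))"
      for \<omega> :: "nat \<Rightarrow> real^'a"
    by (simp only: sum_ennreal Z0 ennreal_plus[symmetric] linf_nonneg sum_nonneg ennreal_leI)
  have "(\<integral>\<^sup>+\<omega>. ennreal (linf (\<Sum>i<n. \<omega> i)) \<partial>?P) \<le>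
      (\<integral>\<^sup>+\<omega>. ennreal (linf (\<Sum>i<n. W (\<omega> i))) + (\<Sum>i<n. ennreal (Z (\<omega> i))) \<partial>?P)"
    by (intro nn_integral_mono le)
  also have "\<dots> = (\<integral>\<^sup>+\<omega>. ennreal (linf (\<Sum>i<n. W (\<omega> i))) \<partial>?P) + (\<Sum>i<n. \<integral>\<^sup>+\<omega>. ennreal (Z (\<omega> i)) \<partial>?P)"
  proof -
    have "(\<integral>\<^sup>+\<omega>. (\<Sum>i<n. ennreal (Z (\<omega> i))) \<partial>?P) = (\<Sum>i<n. \<integral>\<^sup>+\<omega>. ennreal (Z (\<omega> i)) \<partial>?P)"
      by (intro nn_integral_sum) measurable
    moreover have "(\<integral>\<^sup>+\<omega>. ennreal (linf (\<Sum>i<n. W (\<omega> i))) + (\<Sum>i<n. ennreal (Z (\<omega> i))) \<partial>?P) =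
        (\<integral>\<^sup>+\<omega>. ennreal (linf (\<Sum>i<n. W (\<omega> i))) \<partial>?P) + (\<integral>\<^sup>+\<omega>. (\<Sum>i<n. ennreal (Z (\<omega> i))) \<partial>?P)"
      by (intro nn_integral_add) measurable
    ultimately show ?thesis by (simp only:)
  qed
  also have "\<dots> \<le> of_nat n * Estar t n q \<sigma> B ?\<tau> + 2 * Mq' t n q \<sigma> B"
  proof (rule add_mono)
    \<comment> \<open>Applying \<open>W\<close> in each coordinate turns the i.i.d. sample from
      \<open>Q\<close> into one from the truncated law.\<close>
    have "PiM {..<n} (\<lambda>_. ?D) = distr ?P (PiM {..<n} (\<lambda>_. borel)) (\<lambda>x. \<lambda>i\<in>{..<n}. W (x i))"
      by (rule PiM_distr_eq) (auto simp: prob_space_law_mean0[OF lQ])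
    then have "(\<integral>\<^sup>+\<omega>. ennreal (linf (\<Sum>i<n. W (\<omega> i))) \<partial>?P) = (\<integral>\<^sup>+\<omega>. ennreal (linf (\<Sum>i<n. \<omega> i)) \<partial>PiM {..<n} (\<lambda>_. ?D))"
      by (simp add: nn_integral_distr)
    also have "\<dots> = of_nat n * (ennreal (1 / real n) * \<dots>)"
      by (simp only: mult.left_commute[of "of_nat n"] ennreal_inverse_of_nat_mult[OF n])
    also have "\<dots> = of_nat n * (\<integral>\<^sup>+\<omega>. ennreal (linf ((1 / real n) *\<^sub>R (\<Sum>i<n. \<omega> i))) \<partial>PiM {..<n} (\<lambda>_. ?D))"
      by (simp only: nn_integral_linf_mean[OF lD])
    also have "\<dots> \<le> of_nat n * Estar t n q \<sigma> B ?\<tau>"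
      unfolding Estar_def by (intro mult_left_mono SUP_upper D) simp
    finally show "(\<integral>\<^sup>+\<omega>. ennreal (linf (\<Sum>i<n. W (\<omega> i))) \<partial>?P) \<le> of_nat n * Estar t n q \<sigma> B ?\<tau>" .
  next
    have "(\<Sum>i<n. \<integral>\<^sup>+\<omega>. ennreal (Z (\<omega> i)) \<partial>?P) = (\<Sum>i<n. \<integral>\<^sup>+x. ennreal (Z x) \<partial>Q)"
      by (intro sum.cong refl nn_integral_PiM_component[where g="\<lambda>x. ennreal (Z x)"])
        (auto simp: prob_space_law_mean0[OF lQ])
    also have "\<dots> = of_nat n * (\<integral>\<^sup>+x. ennreal (Z x) \<partial>Q)" by simp
    also have "\<dots> \<le> 2 * (\<integral>\<^sup>+\<omega>. ennreal (Max ((\<lambda>i. Z (\<omega> i)) ` {..<n})) \<partial>?P)"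
    proof (rule nn_integral_sum_le_Max[OF prob_space_law_mean0[OF lQ] n])
      have "(\<integral>\<^sup>+x. ennreal (Z x) \<partial>Q) \<le> (\<integral>\<^sup>+x. ennreal (linf x) \<partial>Q)"
        by (intro nn_integral_mono) (auto simp: Z_def)
      then show "(\<integral>\<^sup>+x. ennreal (Z x) \<partial>Q) < \<infinity>"
        using nn_integral_linf_finite[OF lQ] by (rule le_less_trans)
      \<comment> \<open>Since \<open>tau\<close> is nonnegative, \<open>Z\<close> is positive
        exactly at the exceedances.\<close>
      have "{x \<in> space Q. Z x > 0} = {x. linf x > ?\<tau>}"
        using tau_properties(1)[OF Q q n B] sets_eq_imp_space_eq[OF sets_law_mean0[OF lQ]]
        by (auto simp: Z_def zero_less_mult_iff)
      then show "emeasure Q {x \<in> space Q. Z x > 0} \<le> ennreal (1 / (8 * real n))"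
        using tau_properties(2)[OF Q q n B] by simp
    qed auto
    also have "\<dots> \<le> 2 * Mq' t n q \<sigma> B"
      unfolding Mq'_def Z_def by (intro mult_left_mono SUP_upper Q) simp
    finally show "(\<Sum>i<n. \<integral>\<^sup>+\<omega>. ennreal (Z (\<omega> i)) \<partial>?P) \<le> 2 * Mq' t n q \<sigma> B" .
  qed
  finally show ?thesis .
qed

section \<open>Normalization by the sample size and conclusion\<close>

lemma ennreal_inverse_mult_eq_divide:
  assumes "n \<ge> 1"
  shows "ennreal (1 / real n) * x = x / of_nat n"
proof -
  have "ennreal (1 / real n) = inverse (of_nat n)"
    using assms by (simp add: ennreal_of_nat_eq_real_of_nat inverse_ennreal divide_inverse)
  then show ?thesis by (simp add: divide_ennreal_def mult.commute)
qed

text \<open>The factor 3 is the price of passing to a symmetric i.i.d. sample, the factor 2 that of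
  comparing the sum of the exceedances with their maximum. \<open>Mq'\<close> suffices because only
  exceedances of \<open>tau\<close> remain after truncation.\<close>

lemma Eq_le:
  assumes q: "q \<ge> 1" and n: "n \<ge> 1" and B: "B \<ge> 0"
  shows "Eq t n q \<sigma> B \<le> 3 * (Estar t n q \<sigma> B (tau t n q \<sigma> B) + 2 * (Mq' t n q \<sigma> B / of_nat n))"
proof -
  let ?E = "Estar t n q \<sigma> B (tau t n q \<sigma> B)" and ?c = "ennreal (1 / real n)"
  have "(\<integral>\<^sup>+\<omega>. ennreal (linf ((1 / real n) *\<^sub>R (\<Sum>i<n. \<omega> i))) \<partial>PiM {..<n} Ps) \<le> 3 * (?E + 2 * (Mq' t n q \<sigma> B / of_nat n))"
    if Ps: "\<And>i. i < n \<Longrightarrow> law_mean0 (Ps i)"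
      and var: "\<And>j. ?c * (\<Sum>i<n. \<integral>\<^sup>+x. ennreal ((x $ j)^2) \<partial>Ps i) \<le> ennreal (\<sigma>^2)"
      and mom: "?c * (\<Sum>i<n. \<integral>\<^sup>+x. ennreal (linf x powr q) \<partial>Ps i) \<le> ennreal (B powr q)"
    for Ps :: "nat \<Rightarrow> (real^'a) measure"
  proof -
    obtain Q where Q: "Q \<in> Pq t q \<sigma> B" "distr Q borel uminus = Q"
      and le: "(\<integral>\<^sup>+\<omega>. ennreal (linf (\<Sum>i<n. \<omega> i)) \<partial>PiM {..<n} Ps) \<le>
        3 * (\<integral>\<^sup>+\<omega>. ennreal (linf (\<Sum>i<n. \<omega> i)) \<partial>PiM {..<n} (\<lambda>_. Q))"
      using ex_symmetric_iid_dominating[of n Ps, OF n Ps var mom] by blast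
    from nn_integral_symmetric_le[OF Q q n B]
    have "(\<integral>\<^sup>+\<omega>. ennreal (linf (\<Sum>i<n. \<omega> i)) \<partial>PiM {..<n} Ps) \<le> 3 * (of_nat n * ?E + 2 * Mq' t n q \<sigma> B)"
      by (intro order_trans[OF le] mult_left_mono) auto
    then have "?c * (\<integral>\<^sup>+\<omega>. ennreal (linf (\<Sum>i<n. \<omega> i)) \<partial>PiM {..<n} Ps) \<le> ?c * (3 * (of_nat n * ?E + 2 * Mq' t n q \<sigma> B))"
      by (rule mult_left_mono) simp
    also have "\<dots> = 3 * (?c * (of_nat n * ?E) + 2 * (?c * Mq' t n q \<sigma> B))"
      by (simp only: distrib_left mult.left_commute)
    also have "\<dots> = 3 * (?E + 2 * (Mq' t n q \<sigma> B / of_nat n))"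
      unfolding ennreal_inverse_of_nat_mult[OF n] unfolding ennreal_inverse_mult_eq_divide[OF n] by (rule refl)
    finally show ?thesis using Ps by (subst nn_integral_linf_mean) auto
  qed
  then show ?thesis unfolding Eq_def by (intro SUP_least) auto
qed

theorem theorem2p2:
  fixes t :: "'p::finite itself" and n :: nat and q \<sigma> B :: real
  assumes "q \<ge> 1" and "n \<ge> 1" and "\<sigma> \<ge> 0" and "B \<ge> 0"
  shows "ennreal (1/4) * (Estar t n q \<sigma> B (tau t n q \<sigma> B) + Mq t n q \<sigma> B / of_nat n) \<le> Eq t n q \<sigma> B
       \<and> Eq t n q \<sigma> B \<le> 128 * (Estar t n q \<sigma> B (tau t n q \<sigma> B) + Mq t n q \<sigma> B / of_nat n)
       \<and> ennreal (1/4) * (Estar t n q \<sigma> B (tau t n q \<sigma> B) + Mq' t n q \<sigma> B / of_nat n) \<le> Eq t n q \<sigma> B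
       \<and> Eq t n q \<sigma> B \<le> 128 * (Estar t n q \<sigma> B (tau t n q \<sigma> B) + Mq' t n q \<sigma> B / of_nat n)"
proof -
  let ?E = "Eq t n q \<sigma> B" and ?S = "Estar t n q \<sigma> B (tau t n q \<sigma> B)"
  let ?M = "Mq t n q \<sigma> B / of_nat n" and ?M' = "Mq' t n q \<sigma> B / of_nat n"
  have M: "?M \<le> ?E"
    using Mq_le_Eq[OF assms(2)] assms(2) by (intro divide_le_posI_ennreal) auto
  have M': "?M' \<le> ?M"
    by (intro divide_right_mono_ennreal Mq'_le_Mq assms)
  \<comment> \<open>A generic \<open>X\<close> serves both \<open>Mq\<close> and \<open>Mq'\<close>.
    Two terms, each at most \<open>Eq\<close>, give the constant \<open>1 / 2\<close>, which is then
    weakened to \<open>1 / 4\<close>.\<close>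
  have lower: "ennreal (1/4) * (?S + X) \<le> ?E" if "X \<le> ?E" for X
  proof -
    have "ennreal (1/4) * (?S + X) \<le> ennreal (1/4) * (2 * ?E)"
      using add_mono[OF Estar_le_Eq[OF assms(2)] that] by (intro mult_left_mono) (auto simp: mult_2)
    also have "\<dots> = ennreal (1/2) * ?E"
      by (simp add: mult.assoc[symmetric] ennreal_mult[symmetric] flip: ennreal_numeral)
    also have "\<dots> \<le> 1 * ?E" by (intro mult_right_mono) (simp_all only: ennreal_le_1, simp_all)
    finally show ?thesis by simp
  qed
  \<comment> \<open>This gives the constant 6, well below 128. As \<open>Mq'\<close> is at most
    \<open>Mq\<close>, the upper bound with \<open>Mq'\<close> implies the one with
    \<open>Mq\<close>.\<close>
  have "?E \<le> 3 * (?S + 2 * ?M')" by (rule Eq_le[OF assms(1,2,4)])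
  also have "\<dots> \<le> 3 * (2 * (?S + ?M'))"
    by (intro mult_left_mono) (auto simp: distrib_left mult_2)
  also have "\<dots> = 6 * (?S + ?M')" by (simp add: mult.assoc[symmetric])
  also have "\<dots> \<le> 128 * (?S + ?M')" by (intro mult_right_mono) auto
  finally have upper: "?E \<le> 128 * (?S + ?M')" .
  also have "\<dots> \<le> 128 * (?S + ?M)" using M' by (intro mult_left_mono add_left_mono) auto
  finally show ?thesis using upper lower[OF M] lower[OF order_trans[OF M' M]] by blast
qed

end
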